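(* Fix $p\in(0,1)$. There is a constant $C>0$ such that the following holds. Let $\{\mu_{l,j}\}_{l,j=0,1,2,\dots}$ be a collection of measures with $\mu_{l,j}\in\mathfrak{M}_{(l+j)/2}$, and suppose the collection is of norm almost finite type, i.e. $$\sum_{l,j\ge 0}M_{l,\frac{l+j}{2}}^{1/2}\,M_{j,\frac{l+j}{2}}^{1/2}\,\varpi_{\frac{l+j}{2}}(\mu_{l,j})<\infty .$$ Then each sesquilinear form $$F_{\mu_{l,j},l,j}(f,g)=\int_{\mathbb{D}}\partial^l f(z)\,\overline{\partial^j g(z)}\,d\mu_{l,j}(z),\qquad f,g\in\mathcal{A}^2(\mathbb{D}),$$ is bounded on $\mathcal{A}^2(\mathbb{D})$ and thus defines a bounded Toeplitz operator $T_{l,j}$ on $\mathcal{A}^2(\mathbb{D})$, which satisfies $$\|T_{l,j}\|\le C\,M_{l,\frac{l+j}{2}}^{1/2}\,M_{j,\frac{l+j}{2}}^{1/2}\,\varpi_{\frac{l+j}{2}}(\mu_{l,j}),$$ and the series $\sum_{l,j}T_{l,j}$ is norm convergent.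
   Context: $\mathbb{D}$ is the open unit disk in $\mathbb{C}$, and $\mathcal{A}^2(\mathbb{D})$ is the Bergman space of analytic functions on $\mathbb{D}$ square integrable with respect to the normalized Lebesgue measure $dV=\pi^{-1}dx\,dy$, with inner product $\langle\cdot,\cdot\rangle$. $\partial^l f=f^{(l)}$ is the $l$-th complex derivative. The Toeplitz operator $T_F$ with a bounded sesquilinear form $F$ on $\mathcal{A}^2(\mathbb{D})$ (linear in the first argument, antilinear in the second) as symbol is the bounded operator with $\langle T_F f,g\rangle=F(f,g)$ for all $f,g\in\mathcal{A}^2(\mathbb{D})$. $\mathbf{D}(z,R)$ is the Euclidean disk with center $z$ and radius $R$. Measures are complex Borel measures on $\mathbb{D}$ whose variation $|\mu|$ is finite on compact subsets of $\mathbb{D}$. For an integer or half-integer $k\ge 0$ (i.e. $2k\in\mathbb{Z}_{\ge 0}$), the class $\mathfrak{M}_k=\mathfrak{M}_{k,p}$ consists of the measures $\mu$ on $\mathbb{D}$ with $$\varpi_k(\mu)=\varpi_{k,p}(\mu):=\sup_{z\in\mathbb{D}}\left\{|\mu|\left(\mathbf{D}(z,\tfrac12(1-|z|))\right)(1-|z|)^{-2(k+1)}\,\Gamma(k+1)^2\,p^{-2k}\right\}<\infty .$$ For integers or half-integers $l,k\ge0$, $M_{l,k}=p^{2(k-l)}\left(\Gamma(l+1)/\Gamma(k+1)\right)^2$. *)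

theory Defs
  imports "HOL-Analysis.Analysis"
begin

section \<open>The Bergman space of the unit disk\<close>

definition dV :: "complex measure" where
  "dV = density (restrict_space lborel (ball 0 1)) (\<lambda>_. ennreal (1 / pi))"

text \<open>Elements are represented by functions on the whole plane that vanish off the disk, so that
  equality in the type is equality on the disk.\<close>

definition bergman_carrier :: "(complex \<Rightarrow> complex) set" where
  "bergman_carrier = {f. f holomorphic_on ball 0 1 \<and> integrable dV (\<lambda>z. (cmod (f z))\<^sup>2)
     \<and> (\<forall>z. z \<notin> ball 0 1 \<longrightarrow> f z = 0)}"

lemma sets_dV [simp, measurable_cong]: "sets dV = sets (restrict_space borel (ball 0 1))"
  unfolding dV_def by (simp add: sets_restrict_space)

lemma space_dV [simp]: "space dV = ball 0 1"
  by (simp add: dV_def space_restrict_space)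

lemma bergman_measurable:
  assumes "f \<in> bergman_carrier"
  shows "f \<in> borel_measurable dV"
proof -
  have "continuous_on (ball 0 1) f"
    using assms by (auto simp: bergman_carrier_def intro: holomorphic_on_imp_continuous_on)
  then have "f \<in> borel_measurable (restrict_space borel (ball 0 1))"
    by (rule borel_measurable_continuous_on_restrict)
  then show ?thesis
    by (simp cong: measurable_cong_sets)
qed

lemma bergman_mult_integrable:
  assumes "f \<in> bergman_carrier" "g \<in> bergman_carrier"
  shows "integrable dV (\<lambda>z. f z * cnj (g z))"
proof (rule Bochner_Integration.integrable_bound)
  show "integrable dV (\<lambda>z. (cmod (f z))\<^sup>2 + (cmod (g z))\<^sup>2)"
    using assms by (auto simp: bergman_carrier_def)
  have [measurable]: "f \<in> borel_measurable dV" "g \<in> borel_measurable dV"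
    using assms by (auto intro: bergman_measurable)
  have "(\<lambda>z. cnj (g z)) \<in> borel_measurable dV"
    by (rule measurable_compose[where g = cnj and N = borel])
       (auto intro!: borel_measurable_continuous_onI continuous_intros)
  then show "(\<lambda>z. f z * cnj (g z)) \<in> borel_measurable dV"
    by simp
  show "AE z in dV. norm (f z * cnj (g z)) \<le> norm ((cmod (f z))\<^sup>2 + (cmod (g z))\<^sup>2)"
  proof (rule AE_I2)
    fix z
    have "2 * (cmod (f z) * cmod (g z)) \<le> (cmod (f z))\<^sup>2 + (cmod (g z))\<^sup>2"
      using sum_squares_bound[of "cmod (f z)" "cmod (g z)"] by simp
    moreover have "0 \<le> cmod (f z) * cmod (g z)"
      by simp
    ultimately have "cmod (f z) * cmod (g z) \<le> (cmod (f z))\<^sup>2 + (cmod (g z))\<^sup>2"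
      by linarith
    then show "norm (f z * cnj (g z)) \<le> norm ((cmod (f z))\<^sup>2 + (cmod (g z))\<^sup>2)"
      by (simp add: norm_mult)
  qed
qed

lemma bergman_carrier_add:
  assumes "f \<in> bergman_carrier" "g \<in> bergman_carrier"
  shows "(\<lambda>z. f z + g z) \<in> bergman_carrier"
proof -
  have "integrable dV (\<lambda>z. (cmod (f z))\<^sup>2 + (cmod (g z))\<^sup>2 + 2 * Re (f z * cnj (g z)))"
    using assms bergman_mult_integrable[OF assms]
    by (intro Bochner_Integration.integrable_add integrable_mult_right integrable_Re)
       (auto simp: bergman_carrier_def)
  moreover have "(\<lambda>z. (cmod (f z))\<^sup>2 + (cmod (g z))\<^sup>2 + 2 * Re (f z * cnj (g z)))
      = (\<lambda>z. (cmod (f z + g z))\<^sup>2)"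
    unfolding cmod_power2 by (rule ext) (simp add: power2_eq_square algebra_simps)
  ultimately show ?thesis
    using assms by (auto simp: bergman_carrier_def intro!: holomorphic_intros)
qed

lemma bergman_carrier_scale:
  assumes "f \<in> bergman_carrier"
  shows "(\<lambda>z. c * f z) \<in> bergman_carrier"
  using assms by (auto simp: bergman_carrier_def norm_mult power_mult_distrib intro!: holomorphic_intros)

lemma bergman_carrier_zero: "(\<lambda>_. 0) \<in> bergman_carrier"
  by (auto simp: bergman_carrier_def)

lemma bergman_eq_zero:
  assumes f: "f \<in> bergman_carrier" and int0: "(LINT z|dV. (cmod (f z))\<^sup>2) = 0"
  shows "f = (\<lambda>_. 0)"
proof -
  have "AE z in dV. (cmod (f z))\<^sup>2 = 0"
    using f int0 by (subst (asm) integral_nonneg_eq_0_iff_AE) (auto simp: bergman_carrier_def)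
  then have "AE z in restrict_space lborel (ball 0 1). f z = 0"
    unfolding dV_def by (subst (asm) AE_density) auto
  then have ae: "AE z in lborel. z \<in> ball 0 1 \<longrightarrow> f z = 0"
    by (subst (asm) AE_restrict_space_iff) auto
  define U where "U = {z \<in> ball 0 1. f z \<noteq> 0}"
  have cont: "continuous_on (ball 0 1) f"
    using f by (auto simp: bergman_carrier_def intro: holomorphic_on_imp_continuous_on)
  have "open (ball 0 1 \<inter> f -` (- {0}))"
    by (intro continuous_open_preimage cont) auto
  moreover have "U = ball 0 1 \<inter> f -` (- {0})"
    by (auto simp: U_def)
  ultimately have "open U"
    by simp
  have "U \<in> null_sets lborel"
  proof -
    have "AE z in lborel. z \<notin> U"
      using ae by (rule eventually_mono) (simp add: U_def)
    then show ?thesis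
      using \<open>open U\<close> by (subst AE_iff_null_sets) auto
  qed
  then have "negligible U"
    by (simp add: negligible_iff_null_sets null_sets_completionI)
  then have "U = {}"
    using open_not_negligible[OF \<open>open U\<close>] by blast
  then have "f z = 0" for z
    using f unfolding bergman_carrier_def U_def by (cases "z \<in> ball 0 1") blast+
  then show ?thesis
    by (rule ext)
qed

typedef bergman = bergman_carrier
  morphisms fun_of Abs_bergman
  using bergman_carrier_zero by blast

setup_lifting type_definition_bergman

definition bergman_inner :: "bergman \<Rightarrow> bergman \<Rightarrow> complex" where
  "bergman_inner f g = (LINT z|dV. fun_of f z * cnj (fun_of g z))"

lift_definition bergman_scaleC :: "complex \<Rightarrow> bergman \<Rightarrow> bergman" is "\<lambda>c f z. c * f z"
  by (rule bergman_carrier_scale)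

text \<open>The library has no class of complex inner product spaces. The type is made a real inner
  product space with the real part of \<^const>\<open>bergman_inner\<close>; its norm is the Bergman norm.\<close>

instantiation bergman :: real_inner
begin

lift_definition zero_bergman :: bergman is "\<lambda>_. 0"
  by (rule bergman_carrier_zero)

lift_definition plus_bergman :: "bergman \<Rightarrow> bergman \<Rightarrow> bergman" is "\<lambda>f g z. f z + g z"
  by (rule bergman_carrier_add)

definition scaleR_bergman :: "real \<Rightarrow> bergman \<Rightarrow> bergman" where
  "scaleR_bergman c f = bergman_scaleC (of_real c) f"

definition uminus_bergman :: "bergman \<Rightarrow> bergman" where
  "uminus_bergman f = bergman_scaleC (- 1) f"

definition minus_bergman :: "bergman \<Rightarrow> bergman \<Rightarrow> bergman" where
  "minus_bergman f g = f + (- g)"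

definition inner_bergman :: "bergman \<Rightarrow> bergman \<Rightarrow> real" where
  "inner_bergman f g = Re (bergman_inner f g)"

definition norm_bergman :: "bergman \<Rightarrow> real" where
  "norm_bergman f = sqrt (inner f f)"

definition dist_bergman :: "bergman \<Rightarrow> bergman \<Rightarrow> real" where
  "dist_bergman f g = norm (f - g)"

definition sgn_bergman :: "bergman \<Rightarrow> bergman" where
  "sgn_bergman f = inverse (norm f) *\<^sub>R f"

definition uniformity_bergman :: "(bergman \<times> bergman) filter" where
  "uniformity_bergman = (INF e\<in>{0 <..}. principal {(f, g). dist f g < e})"

definition open_bergman :: "bergman set \<Rightarrow> bool" where
  "open_bergman U = (\<forall>f\<in>U. eventually (\<lambda>(f', g). f' = f \<longrightarrow> g \<in> U) uniformity)"

instance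
proof
  have int: "integrable dV (\<lambda>z. fun_of f z * cnj (fun_of g z))" for f g :: bergman
    using bergman_mult_integrable fun_of by blast
  have Re_inner: "inner f g = (LINT z|dV. Re (fun_of f z * cnj (fun_of g z)))" for f g :: bergman
    unfolding inner_bergman_def bergman_inner_def by (rule integral_Re[OF int, symmetric])
  have intRe: "integrable dV (\<lambda>z. Re (fun_of f z * cnj (fun_of g z)))" for f g :: bergman
    by (rule integrable_Re[OF int])
  have inner_self: "inner f f = (LINT z|dV. (cmod (fun_of f z))\<^sup>2)" for f :: bergman
    unfolding Re_inner by (rule Bochner_Integration.integral_cong) (auto simp: complex_mult_cnj cmod_power2)
  fix f g h :: bergman and a b r :: real and U :: "bergman set"
  show "f + g + h = f + (g + h)"
    by transfer (simp add: add.assoc)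
  show "f + g = g + f"
    by transfer (simp add: add.commute)
  show "0 + f = f"
    by transfer simp
  show "- f + f = 0"
    unfolding uminus_bergman_def by transfer simp
  show "f - g = f + - g"
    by (simp add: minus_bergman_def)
  show "a *\<^sub>R (f + g) = a *\<^sub>R f + a *\<^sub>R g"
    unfolding scaleR_bergman_def by transfer (simp add: algebra_simps)
  show "(a + b) *\<^sub>R f = a *\<^sub>R f + b *\<^sub>R f"
    unfolding scaleR_bergman_def by transfer (simp add: algebra_simps)
  show "a *\<^sub>R b *\<^sub>R f = (a * b) *\<^sub>R f"
    unfolding scaleR_bergman_def by transfer (simp add: algebra_simps)
  show "1 *\<^sub>R f = f"
    unfolding scaleR_bergman_def by transfer simp
  show "dist f g = norm (f - g)"
    by (simp add: dist_bergman_def)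
  show "sgn f = inverse (norm f) *\<^sub>R f"
    by (simp add: sgn_bergman_def)
  show "(uniformity :: (bergman \<times> bergman) filter) = (INF e\<in>{0 <..}. principal {(f, g). dist f g < e})"
    by (simp add: uniformity_bergman_def)
  show "open U = (\<forall>f\<in>U. eventually (\<lambda>(f', g). f' = f \<longrightarrow> g \<in> U) uniformity)"
    by (simp add: open_bergman_def)
  show "inner f g = inner g f"
    unfolding Re_inner by (simp add: algebra_simps)
  have "inner (f + g) h = (LINT z|dV. Re (fun_of f z * cnj (fun_of h z)) + Re (fun_of g z * cnj (fun_of h z)))"
    unfolding Re_inner plus_bergman.rep_eq by (simp add: algebra_simps)
  also have "\<dots> = inner f h + inner g h"
    unfolding Re_inner using intRe by (rule Bochner_Integration.integral_add) (rule intRe)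
  finally show "inner (f + g) h = inner f h + inner g h" .
  have "inner (r *\<^sub>R f) g = (LINT z|dV. r * Re (fun_of f z * cnj (fun_of g z)))"
    unfolding Re_inner scaleR_bergman_def bergman_scaleC.rep_eq by (simp add: algebra_simps)
  then show "inner (r *\<^sub>R f) g = r * inner f g"
    unfolding Re_inner by simp
  show "0 \<le> inner f f"
    unfolding inner_self by simp
  show "inner f f = 0 \<longleftrightarrow> f = 0"
  proof
    assume "inner f f = 0"
    then have "fun_of f = (\<lambda>_. 0)"
      unfolding inner_self using fun_of by (rule bergman_eq_zero[rotated])
    then show "f = 0"
      by transfer simp
  next
    assume "f = 0"
    then show "inner f f = 0"
      unfolding inner_self by (simp add: zero_bergman.rep_eq)
  qed
  show "norm f = sqrt (inner f f)"
    by (simp add: norm_bergman_def)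
qed

end

lemma norm_bergman_eq: "norm f = sqrt (LINT z|dV. (cmod (fun_of f z))\<^sup>2)"
proof -
  have "(LINT z|dV. fun_of f z * cnj (fun_of f z)) = (LINT z|dV. of_real ((cmod (fun_of f z))\<^sup>2))"
    by (intro arg_cong[where f = "integral\<^sup>L dV"] ext) (simp add: complex_norm_square[symmetric])
  also have "\<dots> = of_real (LINT z|dV. (cmod (fun_of f z))\<^sup>2)"
    by (rule integral_complex_of_real)
  finally show ?thesis
    by (simp only: norm_bergman_def inner_bergman_def bergman_inner_def Re_complex_of_real)
qed


section \<open>Sesquilinear forms and Toeplitz operators\<close>

definition bounded_sesquilinear :: "(bergman \<Rightarrow> bergman \<Rightarrow> complex) \<Rightarrow> bool" where
  "bounded_sesquilinear F \<longleftrightarrow> bounded_bilinear F \<and>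
     (\<forall>c f g. F (bergman_scaleC c f) g = c * F f g \<and> F f (bergman_scaleC c g) = cnj c * F f g)"

definition is_Toeplitz :: "(bergman \<Rightarrow> bergman \<Rightarrow> complex) \<Rightarrow> (bergman \<Rightarrow>\<^sub>L bergman) \<Rightarrow> bool" where
  "is_Toeplitz F T \<longleftrightarrow>
     (\<forall>c f. blinfun_apply T (bergman_scaleC c f) = bergman_scaleC c (blinfun_apply T f)) \<and>
     (\<forall>f g. bergman_inner (blinfun_apply T f) g = F f g)"


section \<open>Complex measures with locally finite variation\<close>

text \<open>The variation may be infinite on the whole disk, so a measure is a set function on the
  relatively compact Borel subsets of the disk; its values on other sets are irrelevant.\<close>

definition rc_borel :: "complex set set" where
  "rc_borel = {A \<in> sets borel. \<exists>K. compact K \<and> A \<subseteq> K \<and> K \<subseteq> ball 0 1}"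

definition variation :: "(complex set \<Rightarrow> complex) \<Rightarrow> complex set \<Rightarrow> ennreal" where
  "variation \<mu> E =
     (SUP A\<in>{A :: nat \<Rightarrow> complex set. range A \<subseteq> rc_borel \<and> disjoint_family A \<and> (\<Union>i. A i) = E}.
        \<Sum>i. ennreal (cmod (\<mu> (A i))))"

definition disk_measure :: "(complex set \<Rightarrow> complex) \<Rightarrow> bool" where
  "disk_measure \<mu> \<longleftrightarrow>
     (\<forall>A :: nat \<Rightarrow> complex set. range A \<subseteq> rc_borel \<longrightarrow> disjoint_family A \<longrightarrow> (\<Union>i. A i) \<in> rc_borel \<longrightarrow>
        (\<lambda>i. \<mu> (A i)) sums \<mu> (\<Union>i. A i)) \<and>
     (\<forall>K. compact K \<longrightarrow> K \<subseteq> ball 0 1 \<longrightarrow> variation \<mu> K < \<infinity>)"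

text \<open>The positive part in the Jordan decomposition of a real set function. Since
  \<^const>\<open>ennreal\<close> sends negative numbers to 0 and the empty set has measure 0, it does not affect
  the supremum.\<close>

definition positive_variation :: "(complex set \<Rightarrow> real) \<Rightarrow> complex measure" where
  "positive_variation \<nu> = measure_of (ball 0 1) (sets (restrict_space borel (ball 0 1)))
     (\<lambda>E. SUP A\<in>{A \<in> rc_borel. A \<subseteq> E}. ennreal (\<nu> A))"

lemma sums_ennreal_le_suminf:
  assumes "x sums s"
  shows "ennreal s \<le> (\<Sum>i. ennreal (x i))"
proof (rule LIMSEQ_le_const2)
  show "(\<lambda>n. ennreal (\<Sum>i<n. x i)) \<longlonglongrightarrow> ennreal s"
    using assms unfolding sums_def by (rule tendsto_ennrealI)
  have "ennreal (\<Sum>i<n. x i) \<le> (\<Sum>i. ennreal (x i))" for n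
  proof -
    have "ennreal (\<Sum>i<n. x i) \<le> ennreal (\<Sum>i<n. max 0 (x i))"
      by (intro ennreal_leI sum_mono) simp
    also have "\<dots> = (\<Sum>i<n. ennreal (max 0 (x i)))"
      by (simp add: sum_ennreal)
    also have "\<dots> = (\<Sum>i<n. ennreal (x i))"
      by (rule sum.cong) (auto simp: max_def ennreal_neg)
    also have "\<dots> \<le> (\<Sum>i. ennreal (x i))"
      by (rule sum_le_suminf) auto
    finally show ?thesis .
  qed
  then show "\<exists>N. \<forall>n\<ge>N. ennreal (\<Sum>i<n. x i) \<le> (\<Sum>i. ennreal (x i))"
    by blast
qed

lemma emeasure_positive_variation:
  assumes additive: "\<And>A :: nat \<Rightarrow> complex set. range A \<subseteq> rc_borel \<Longrightarrow> disjoint_family A \<Longrightarrow>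
      (\<Union>i. A i) \<in> rc_borel \<Longrightarrow> (\<lambda>i. \<nu> (A i)) sums \<nu> (\<Union>i. A i)"
    and E: "E \<in> sets (restrict_space borel (ball 0 1))"
  shows "emeasure (positive_variation \<nu>) E = (SUP A\<in>{A \<in> rc_borel. A \<subseteq> E}. ennreal (\<nu> A))"
proof -
  define m where "m E = (SUP A\<in>{A \<in> rc_borel. A \<subseteq> E}. ennreal (\<nu> A))" for E
  have empty_rc: "{} \<in> rc_borel"
    by (auto simp: rc_borel_def)
  have sub_rc: "A \<inter> B \<in> rc_borel" if "A \<in> rc_borel" "B \<in> sets borel" for A B
    using that unfolding rc_borel_def by blast
  have Un_rc: "A \<union> B \<in> rc_borel" if A: "A \<in> rc_borel" and B: "B \<in> rc_borel" for A B
  proof -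
    obtain K L where "compact K" "A \<subseteq> K" "K \<subseteq> ball 0 1" "compact L" "B \<subseteq> L" "L \<subseteq> ball 0 1"
      using A B unfolding rc_borel_def by blast
    then have "compact (K \<union> L)" "A \<union> B \<subseteq> K \<union> L" "K \<union> L \<subseteq> ball 0 1"
      by (auto intro: compact_Un)
    then show ?thesis
      using A B unfolding rc_borel_def by blast
  qed
  have nu_empty: "\<nu> {} = 0"
  proof -
    have "(\<lambda>i::nat. \<nu> {}) sums \<nu> {}"
      using additive[of "\<lambda>_. {}"] empty_rc by (simp add: disjoint_family_on_def)
    then have "(\<lambda>i::nat. \<nu> {}) \<longlonglongrightarrow> 0"
      using sums_summable summable_LIMSEQ_zero by blast
    then show ?thesis
      by (simp add: LIMSEQ_const_iff)
  qed
  have nu_Un: "\<nu> (A \<union> B) = \<nu> A + \<nu> B" if "A \<in> rc_borel" "B \<in> rc_borel" "A \<inter> B = {}" for A B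
  proof -
    have "(\<lambda>i. \<nu> (binaryset A B i)) sums \<nu> (\<Union>i. binaryset A B i)"
      using that empty_rc Un_rc
      by (intro additive) (auto simp: disjoint_family_on_def UN_binaryset_eq binaryset_def)
    moreover have "(\<lambda>i. \<nu> (binaryset A B i)) sums (\<nu> A + \<nu> B)"
      by (rule binaryset_sums) (rule nu_empty)
    ultimately show ?thesis
      using sums_unique2 by (metis UN_binaryset_eq)
  qed
  have upper: "ennreal (\<nu> A) \<le> m E" if "A \<in> rc_borel" "A \<subseteq> E" for A E
    unfolding m_def using that by (intro SUP_upper) simp
  have m_empty: "m {} = 0"
    using empty_rc nu_empty unfolding m_def by (simp add: subset_empty conj_commute cong: conj_cong)
  have superadd: "m X + m Y \<le> m (X \<union> Y)" if "X \<inter> Y = {}" for X Y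
  proof -
    have "ennreal (\<nu> A) + ennreal (\<nu> B) \<le> m (X \<union> Y)"
      if A: "A \<in> rc_borel" "A \<subseteq> X" and B: "B \<in> rc_borel" "B \<subseteq> Y" for A B
    proof -
      consider "\<nu> A \<le> 0" | "\<nu> B \<le> 0" | "0 \<le> \<nu> A" "0 \<le> \<nu> B"
        by linarith
      then show ?thesis
      proof cases
        case 1
        then show ?thesis
          using upper[of B "X \<union> Y"] B by (auto simp: ennreal_neg)
      next
        case 2
        then show ?thesis
          using upper[of A "X \<union> Y"] A by (auto simp: ennreal_neg)
      next
        case 3
        have "A \<inter> B = {}"
          using \<open>X \<inter> Y = {}\<close> A B by blast
        then have "ennreal (\<nu> A) + ennreal (\<nu> B) = ennreal (\<nu> (A \<union> B))"
          using 3 A B nu_Un by simp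
        also have "\<dots> \<le> m (X \<union> Y)"
          using A B by (intro upper Un_rc) auto
        finally show ?thesis .
      qed
    qed
    note le = this
    have ne: "{A \<in> rc_borel. A \<subseteq> Z} \<noteq> {}" for Z
      using empty_rc by blast
    have "m X + m Y = (SUP A\<in>{A \<in> rc_borel. A \<subseteq> X}. ennreal (\<nu> A) + m Y)"
      unfolding m_def[of X] using ne by (rule ennreal_SUP_add_left[symmetric])
    also have "\<dots> \<le> m (X \<union> Y)"
    proof (rule SUP_least)
      fix A assume A: "A \<in> {A \<in> rc_borel. A \<subseteq> X}"
      have "ennreal (\<nu> A) + m Y = (SUP B\<in>{B \<in> rc_borel. B \<subseteq> Y}. ennreal (\<nu> A) + ennreal (\<nu> B))"
        unfolding m_def[of Y] by (subst ennreal_SUP_add_right[OF ne]) (rule refl)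
      also have "\<dots> \<le> m (X \<union> Y)"
        using A le by (intro SUP_least) auto
      finally show "ennreal (\<nu> A) + m Y \<le> m (X \<union> Y)" .
    qed
    finally show ?thesis .
  qed
  have mono: "m X \<le> m Y" if "X \<subseteq> Y" for X Y
    unfolding m_def using that by (intro SUP_subset_mono) auto
  have "countably_additive (sets (restrict_space borel (ball 0 1))) m"
  proof (rule countably_additiveI)
    fix X :: "nat \<Rightarrow> complex set"
    assume X: "range X \<subseteq> sets (restrict_space borel (ball 0 1))" "disjoint_family X"
    have X_borel: "X i \<in> sets borel" for i
    proof -
      have "X i \<in> sets (restrict_space borel (ball 0 1))"
        using X(1) by blast
      then show ?thesis
        using sets_restrict_space_iff[of "ball (0::complex) 1" borel] by simp
    qed
    show "(\<Sum>i. m (X i)) = m (\<Union>i. X i)"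
    proof (rule antisym)
      have "(\<Sum>i<n. m (X i)) \<le> m (\<Union>i<n. X i)" for n
      proof (induction n)
        case 0
        then show ?case
          by (simp add: m_empty)
      next
        case (Suc n)
        have "(\<Union>i<n. X i) \<inter> X n = {}"
        proof -
          have "X i \<inter> X n = {}" if "i < n" for i
            using X(2) that unfolding disjoint_family_on_def by (metis UNIV_I less_irrefl)
          then show ?thesis
            by blast
        qed
        then have "m (\<Union>i<n. X i) + m (X n) \<le> m ((\<Union>i<n. X i) \<union> X n)"
          by (rule superadd)
        moreover have "(\<Union>i<n. X i) \<union> X n = (\<Union>i<Suc n. X i)"
          by (auto simp: lessThan_Suc)
        ultimately have "m (\<Union>i<n. X i) + m (X n) \<le> m (\<Union>i<Suc n. X i)"
          by (simp only:)
        moreover have "(\<Sum>i<Suc n. m (X i)) \<le> m (\<Union>i<n. X i) + m (X n)"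
          using add_right_mono[OF Suc] by simp
        ultimately show ?case
          by (rule order_trans[rotated])
      qed
      then have "(\<Sum>i<n. m (X i)) \<le> m (\<Union>i. X i)" for n
        by (rule order_trans) (auto intro: mono)
      then show "(\<Sum>i. m (X i)) \<le> m (\<Union>i. X i)"
        by (intro suminf_le_const summableI)
      show "m (\<Union>i. X i) \<le> (\<Sum>i. m (X i))"
        unfolding m_def[of "\<Union>i. X i"]
      proof (rule SUP_least)
        fix A assume "A \<in> {A \<in> rc_borel. A \<subseteq> (\<Union>i. X i)}"
        then have A: "A \<in> rc_borel" "(\<Union>i. A \<inter> X i) = A"
          by auto
        have "(\<lambda>i. \<nu> (A \<inter> X i)) sums \<nu> (\<Union>i. A \<inter> X i)"
          using A X(2) X_borel sub_rc
          by (intro additive) (auto simp: disjoint_family_on_def)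
        then have "ennreal (\<nu> A) \<le> (\<Sum>i. ennreal (\<nu> (A \<inter> X i)))"
          using A by (simp add: sums_ennreal_le_suminf)
        also have "\<dots> \<le> (\<Sum>i. m (X i))"
          using A X_borel sub_rc by (intro suminf_le upper summableI) auto
        finally show "ennreal (\<nu> A) \<le> (\<Sum>i. m (X i))" .
      qed
    qed
  qed
  moreover have "positive (sets (restrict_space borel (ball 0 1))) m"
    by (simp add: positive_def m_empty)
  moreover have "positive_variation \<nu> =
      measure_of (ball 0 1) (sets (restrict_space borel (ball 0 1))) m"
    unfolding positive_variation_def m_def ..
  moreover have "sets (restrict_space borel (ball 0 1)) \<subseteq> Pow (ball (0::complex) 1)"
    using sets.space_closed[of "restrict_space borel (ball (0::complex) 1)"]
    by (simp add: space_restrict_space)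
  moreover have "sets (positive_variation \<nu>) = sets (restrict_space borel (ball 0 1))"
    using calculation(3,4) sets.sets_measure_of_eq[of "restrict_space borel (ball (0::complex) 1)"]
    by (simp add: space_restrict_space)
  ultimately show ?thesis
    using E emeasure_measure_of[of "positive_variation \<nu>" "ball 0 1"
        "sets (restrict_space borel (ball 0 1))" m E]
    unfolding m_def[symmetric] by simp
qed

definition cintegrable :: "(complex set \<Rightarrow> complex) \<Rightarrow> (complex \<Rightarrow> complex) \<Rightarrow> bool" where
  "cintegrable \<mu> \<phi> \<longleftrightarrow>
     integrable (positive_variation (\<lambda>A. Re (\<mu> A))) \<phi> \<and>
     integrable (positive_variation (\<lambda>A. - Re (\<mu> A))) \<phi> \<and>
     integrable (positive_variation (\<lambda>A. Im (\<mu> A))) \<phi> \<and>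
     integrable (positive_variation (\<lambda>A. - Im (\<mu> A))) \<phi>"

definition cintegral :: "(complex set \<Rightarrow> complex) \<Rightarrow> (complex \<Rightarrow> complex) \<Rightarrow> complex" where
  "cintegral \<mu> \<phi> =
     (LINT z|positive_variation (\<lambda>A. Re (\<mu> A)). \<phi> z) -
     (LINT z|positive_variation (\<lambda>A. - Re (\<mu> A)). \<phi> z) +
     \<i> * ((LINT z|positive_variation (\<lambda>A. Im (\<mu> A)). \<phi> z) -
          (LINT z|positive_variation (\<lambda>A. - Im (\<mu> A)). \<phi> z))"


section \<open>The classes of measures and the forms they define\<close>

definition varpi :: "real \<Rightarrow> real \<Rightarrow> (complex set \<Rightarrow> complex) \<Rightarrow> ennreal" where
  "varpi p k \<mu> =
     (SUP z\<in>ball 0 1. variation \<mu> (ball z (1/2 * (1 - cmod z))) *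
        ennreal ((1 - cmod z) powr (- 2 * (k + 1)) * (Gamma (k + 1))\<^sup>2 * p powr (- 2 * k)))"

definition M_class :: "real \<Rightarrow> real \<Rightarrow> (complex set \<Rightarrow> complex) set" where
  "M_class p k = {\<mu>. disk_measure \<mu> \<and> varpi p k \<mu> < \<infinity>}"

definition M_coeff :: "real \<Rightarrow> real \<Rightarrow> real \<Rightarrow> real" where
  "M_coeff p l k = p powr (2 * (k - l)) * (Gamma (l + 1) / Gamma (k + 1))\<^sup>2"

definition norm_bound :: "real \<Rightarrow> (nat \<Rightarrow> nat \<Rightarrow> complex set \<Rightarrow> complex) \<Rightarrow> nat \<Rightarrow> nat \<Rightarrow> ennreal" where
  "norm_bound p \<mu> l j =
     ennreal (sqrt (M_coeff p (real l) ((real l + real j) / 2)) *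
              sqrt (M_coeff p (real j) ((real l + real j) / 2))) *
     varpi p ((real l + real j) / 2) (\<mu> l j)"

definition norm_almost_finite_type :: "real \<Rightarrow> (nat \<Rightarrow> nat \<Rightarrow> complex set \<Rightarrow> complex) \<Rightarrow> bool" where
  "norm_almost_finite_type p \<mu> \<longleftrightarrow> (\<Sum>\<^sub>\<infinity>(l, j)\<in>UNIV. norm_bound p \<mu> l j) < \<infinity>"

definition form_integrand :: "nat \<Rightarrow> nat \<Rightarrow> bergman \<Rightarrow> bergman \<Rightarrow> complex \<Rightarrow> complex" where
  "form_integrand l j f g z = (deriv ^^ l) (fun_of f) z * cnj ((deriv ^^ j) (fun_of g) z)"

definition measure_form ::
    "(complex set \<Rightarrow> complex) \<Rightarrow> nat \<Rightarrow> nat \<Rightarrow> bergman \<Rightarrow> bergman \<Rightarrow> complex" where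
  "measure_form \<mu> l j f g = cintegral \<mu> (form_integrand l j f g)"

end

theory Submission
  imports Defs "HOL-Complex_Analysis.Cauchy_Integral_Formula"
begin

text \<open>The forms are controlled by a Carleson measure estimate whose constant does not depend on the
  orders of differentiation. Let \<open>\<sigma>\<close> be one of the four positive parts of the measure and suppose that it
  gives the disk of radius \<open>(1 - \<bar>w\<bar>) / 2\<close> around \<open>w\<close> at most the mass
  \<open>K (1 - \<bar>w\<bar>) ^ (l + j + 2) p ^ (l + j)\<close>; for the class of index \<open>(l + j) / 2\<close> this holds with \<open>K\<close> equal to
  \<open>\<varpi> / \<Gamma>\<^sup>2\<close>. If \<open>d = 1 - \<bar>w\<bar>\<close> and \<open>z\<close> is within \<open>e d\<close> of \<open>w\<close>, then Cauchy's
  inequality on a circle of radius exactly \<open>p d\<close>, followed by the mean value inequality on disks of radius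
  \<open>e d\<close>, bounds the \<open>l\<close>-th derivative of \<open>f\<close> at \<open>z\<close> by \<open>l! (p d) ^ (- l) / d\<close> times the norm of \<open>f\<close> in
  \<open>L\<^sup>2\<close> of a disk of radius \<open>(p + 2 e) d\<close> around \<open>w\<close>, up to a constant that depends on \<open>e\<close> only. Since \<open>p < 1\<close>,
  one can take \<open>e = (1 - p) / 3\<close>, and then that disk still has radius less than \<open>d\<close>. In the product of the
  bounds for \<open>f\<close>, \<open>g\<close> and \<open>\<sigma>\<close> every power of \<open>p\<close> and \<open>d\<close> cancels, and \<open>K l! j!\<close> is left, which is
  precisely the quantity in the theorem (\<open>higher_deriv_product_bound\<close>, \<open>carleson_embedding\<close>).

  The local estimates are put together by averaging over \<open>w\<close> with the weight \<open>(1 - \<bar>w\<bar>) ^ (-2)\<close>, for which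
  disks of radius proportional to \<open>1 - \<bar>w\<bar>\<close> have bounded size from above and below
  (\<open>whitney_weight_lower\<close>, \<open>whitney_weight_upper\<close>). Fubini's theorem thus replaces a covering
  argument. The mean value inequality over areas (\<open>area_mean_value_inequality\<close>) is obtained from Cauchy's
  formula and the invariance of planar Lebesgue measure under rotations.

  A bounded form gives a Toeplitz operator by the Riesz representation theorem, which requires the
  Bergman space to be complete. Completeness of the space of operators then turns the summability of the
  norm bounds into norm convergence of the series.\<close>

section \<open>Mean value inequalities for areas\<close>

lemma nn_integral_lborel_translate:
  fixes \<phi> :: "'a::euclidean_space \<Rightarrow> ennreal"
  assumes [measurable]: "\<phi> \<in> borel_measurable borel"
  shows "(\<integral>\<^sup>+x. \<phi> (a + x) \<partial>lborel) = (\<integral>\<^sup>+x. \<phi> x \<partial>lborel)"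
proof -
  have "(\<integral>\<^sup>+x. \<phi> x \<partial>lborel) = (\<integral>\<^sup>+x. \<phi> x \<partial>distr lborel borel ((+) a))"
    by (simp add: lborel_distr_plus)
  also have "\<dots> = (\<integral>\<^sup>+x. \<phi> (a + x) \<partial>lborel)"
    by (rule nn_integral_distr) auto
  finally show ?thesis by simp
qed

text \<open>Instead of computing how a rotation acts on boxes, the proof compares two ways of integrating
  \<open>\<kappa> (y - c x) \<phi> (c x)\<close> over the pairs \<open>(x, y)\<close>, where \<open>\<kappa>\<close> is the indicator of the unit disk. Translation
  invariance in \<open>y\<close> turns the double integral into the area \<open>b\<close> of the disk times the left-hand side;
  the shift \<open>x \<mapsto> y / c + x\<close> turns it into \<open>b\<close> times the right-hand side, because the disk itself is
  invariant under rotation. It remains to cancel \<open>b\<close>.\<close>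

lemma nn_integral_lborel_rotate:
  fixes \<phi> :: "complex \<Rightarrow> ennreal"
  assumes \<phi>[measurable]: "\<phi> \<in> borel_measurable borel" and c: "cmod c = 1"
  shows "(\<integral>\<^sup>+x. \<phi> (c * x) \<partial>lborel) = (\<integral>\<^sup>+x. \<phi> x \<partial>lborel)"
proof -
  define \<kappa> :: "complex \<Rightarrow> ennreal" where "\<kappa> = indicator (ball 0 1)"
  define b where "b = (\<integral>\<^sup>+x. \<kappa> x \<partial>lborel)"
  have [measurable]: "\<kappa> \<in> borel_measurable borel"
    unfolding \<kappa>_def by (intro borel_measurable_indicator) simp
  have b: "b \<noteq> 0" "b \<noteq> top"
    by (simp_all add: b_def \<kappa>_def emeasure_ball unit_ball_vol_2)
  have "c \<noteq> 0" using c by auto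
  have b1: "(\<integral>\<^sup>+y. \<kappa> (y - a) \<partial>lborel) = b" for a :: complex
    using nn_integral_lborel_translate[of \<kappa> "-a"] by (simp add: b_def)
  have "b * (\<integral>\<^sup>+x. \<phi> (c * x) \<partial>lborel)
      = (\<integral>\<^sup>+x. (\<integral>\<^sup>+y. \<kappa> (y - c * x) * \<phi> (c * x) \<partial>lborel) \<partial>lborel)"
    by (subst nn_integral_multc) (simp_all add: b1 nn_integral_cmult)
  also have "\<dots> = (\<integral>\<^sup>+y. (\<integral>\<^sup>+x. \<kappa> (y - c * x) * \<phi> (c * x) \<partial>lborel) \<partial>lborel)"
    by (rule lborel_pair.Fubini'[symmetric]) measurable
  also have "\<dots> = (\<integral>\<^sup>+y. (\<integral>\<^sup>+x. \<kappa> (y - c * (y / c + x)) * \<phi> (c * (y / c + x)) \<partial>lborel) \<partial>lborel)"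
    by (intro nn_integral_cong nn_integral_lborel_translate[symmetric]) measurable
  also have "\<dots> = (\<integral>\<^sup>+y. (\<integral>\<^sup>+x. \<kappa> x * \<phi> (c * x + y) \<partial>lborel) \<partial>lborel)"
    using \<open>c \<noteq> 0\<close> by (intro nn_integral_cong) (simp add: \<kappa>_def indicator_def c norm_mult algebra_simps)
  also have "\<dots> = (\<integral>\<^sup>+x. (\<integral>\<^sup>+y. \<kappa> x * \<phi> (c * x + y) \<partial>lborel) \<partial>lborel)"
    by (rule lborel_pair.Fubini') measurable
  also have "\<dots> = b * (\<integral>\<^sup>+x. \<phi> x \<partial>lborel)"
    by (simp add: nn_integral_cmult nn_integral_multc nn_integral_lborel_translate b_def)
  finally show ?thesis
    using b by (simp add: ennreal_mult_cancel_left)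
qed

text \<open>This is Cauchy's formula on the unit circle for the function \<open>\<zeta> \<mapsto> f (z + \<zeta> u)\<close>; taking \<open>u\<close> as a
  parameter makes \<open>u = 0\<close> an ordinary case and prepares the average over \<open>u\<close> below.\<close>

lemma cmod_le_circle_average:
  assumes f: "f holomorphic_on ball z R" and u: "cmod u < R"
  shows "ennreal (cmod (f z)) \<le> (\<integral>\<^sup>+t\<in>{0..1}. ennreal (cmod (f (z + cis (2 * pi * t) * u))) \<partial>lborel)"
proof -
  define g where "g \<zeta> = f (z + \<zeta> * u)" for \<zeta>
  have in_ball: "z + \<zeta> * u \<in> ball z R" if "cmod \<zeta> \<le> 1" for \<zeta>
  proof -
    have "cmod (\<zeta> * u) \<le> 1 * cmod u"
      unfolding norm_mult using that by (intro mult_right_mono) auto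
    then show ?thesis using u by (simp add: dist_norm)
  qed
  have holg: "g holomorphic_on cball 0 1"
    unfolding g_def using in_ball
    by (intro holomorphic_on_compose_gen[OF _ f, unfolded o_def] holomorphic_intros) auto
  have "((\<lambda>\<zeta>. g \<zeta> / (\<zeta> - 0)) has_contour_integral 2 * of_real pi * \<i> * g 0) (circlepath 0 1)"
    using holg by (intro Cauchy_integral_circlepath_simple) auto
  then have "((\<lambda>t. g (cis (2 * pi * t)) * (2 * pi * \<i>)) has_integral 2 * of_real pi * \<i> * g 0) {0..1}"
    unfolding has_contour_integral_def
    by (rule has_integral_eq[rotated])
       (subst vector_derivative_circlepath01,
        simp_all add: circlepath cis_conv_exp field_simps)
  then have I: "((\<lambda>t. g (cis (2 * pi * t))) has_integral g 0) {0..1}"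
    by (drule_tac has_integral_mult_left[where c = "1 / (2 * pi * \<i>)"]) simp
  have cont: "continuous_on {0..1} (\<lambda>t. g (cis (2 * pi * t)))"
    by (rule continuous_on_compose2[OF holomorphic_on_imp_continuous_on[OF holg]])
       (auto intro!: continuous_intros)
  have "cmod (g 0) \<le> integral {0..1} (\<lambda>t. cmod (g (cis (2 * pi * t))))"
    using integral_norm_bound_integral[OF integrable_continuous_interval[OF cont]
        integrable_continuous_interval[OF continuous_on_norm[OF cont]]] I
    by (simp add: integral_unique)
  moreover have "(\<integral>\<^sup>+t. ennreal (indicator {0..1} t * cmod (g (cis (2 * pi * t)))) \<partial>lborel)
      = ennreal (integral {0..1} (\<lambda>t. cmod (g (cis (2 * pi * t)))))"
    using integrable_continuous_interval[OF continuous_on_norm[OF cont]]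
    by (intro nn_integral_has_integral_lebesgue integrable_integral) auto
  ultimately show ?thesis
    by (simp add: g_def ennreal_mult mult.commute ennreal_indicator ennreal_leI
        flip: ennreal_indicator)
qed

text \<open>The circle average is integrated over \<open>\<bar>u\<bar> < r\<close>. After exchanging the integrals, the inner integral
  over \<open>u\<close> does not depend on the angle, by rotation invariance. This does the work of polar
  coordinates.\<close>

lemma area_mean_value_inequality:
  assumes h: "h holomorphic_on ball z r" and r: "r > 0" and [measurable]: "h \<in> borel_measurable borel"
  shows "ennreal (pi * r\<^sup>2 * cmod (h z)) \<le> (\<integral>\<^sup>+u\<in>ball z r. ennreal (cmod (h u)) \<partial>lborel)"
proof -
  define H where "H v = ennreal (cmod (h (z + v))) * indicator (ball 0 r) v" for v
  have [measurable]: "(indicator (ball 0 r) :: complex \<Rightarrow> ennreal) \<in> borel_measurable borel"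
    by (intro borel_measurable_indicator) simp
  have [measurable]: "H \<in> borel_measurable borel"
    unfolding H_def by measurable
  have cis[measurable]: "(\<lambda>t. cis (2 * pi * t)) \<in> borel_measurable borel"
    by (intro borel_measurable_continuous_onI continuous_intros)
  have "ennreal (pi * r\<^sup>2 * cmod (h z)) = (\<integral>\<^sup>+u\<in>ball 0 r. ennreal (cmod (h z)) \<partial>(lborel :: complex measure))"
    using r by (subst nn_integral_cmult) (simp_all add: emeasure_ball unit_ball_vol_2 ennreal_mult mult_ac)
  also have "\<dots> \<le> (\<integral>\<^sup>+u. (\<integral>\<^sup>+t. H (cis (2 * pi * t) * u) * indicator {0..1} t \<partial>lborel) \<partial>lborel)"
  proof (rule nn_integral_mono)
    fix u :: complex
    show "ennreal (cmod (h z)) * indicator (ball 0 r) u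
        \<le> (\<integral>\<^sup>+t. H (cis (2 * pi * t) * u) * indicator {0..1} t \<partial>lborel)"
      using cmod_le_circle_average[OF h, of u]
      by (cases "cmod u < r") (simp_all add: H_def norm_mult)
  qed
  also have "\<dots> = (\<integral>\<^sup>+t. (\<integral>\<^sup>+u. H (cis (2 * pi * t) * u) * indicator {0..1} t \<partial>lborel) \<partial>lborel)"
    by (rule lborel_pair.Fubini') measurable
  also have "\<dots> = (\<integral>\<^sup>+t. (\<integral>\<^sup>+u. H u \<partial>lborel) * indicator {0..1::real} t \<partial>lborel)"
    by (intro nn_integral_cong, subst nn_integral_multc) (simp_all add: nn_integral_lborel_rotate)
  also have "\<dots> = (\<integral>\<^sup>+u. H u \<partial>lborel)"
    by (subst nn_integral_cmult) simp_all
  also have "\<dots> = (\<integral>\<^sup>+u. H (- z + u) \<partial>lborel)"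
    by (rule nn_integral_lborel_translate[symmetric]) measurable
  also have "\<dots> = (\<integral>\<^sup>+u\<in>ball z r. ennreal (cmod (h u)) \<partial>lborel)"
    by (intro nn_integral_cong) (simp add: H_def indicator_def dist_norm norm_minus_commute)
  finally show ?thesis .
qed

text \<open>Cauchy's inequality on the circle of radius \<open>r\<close> costs \<open>(n! / r ^ n)\<^sup>2\<close>, the mean value inequality for
  \<open>f\<^sup>2\<close> on disks of radius \<open>s\<close> around the points of that circle costs \<open>1 / (\<pi> s\<^sup>2)\<close>. Two separate radii
  are used so that the factor which grows with \<open>n\<close> involves \<open>r\<close> alone: it can then be matched exactly
  with the factor \<open>p\<close> in the classes of measures, and no constant to the power \<open>n\<close> is left over.\<close>

lemma higher_deriv_area_bound:
  assumes f: "f holomorphic_on ball z (r + s)" and [measurable]: "f \<in> borel_measurable borel"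
    and r: "r > 0" and s: "s > 0"
  shows "ennreal ((cmod ((deriv ^^ n) f z))\<^sup>2)
    \<le> ennreal ((fact n / r ^ n)\<^sup>2 / (pi * s\<^sup>2)) * (\<integral>\<^sup>+u\<in>ball z (r + s). ennreal ((cmod (f u))\<^sup>2) \<partial>lborel)"
    (is "_ \<le> ennreal ?c * ?I")
proof (cases "?I")
  case top
  have "ennreal ?c * ?I = top"
    unfolding top using r s by (simp add: ennreal_mult_top)
  then show ?thesis by (metis top_greatest)
next
  case (real i)
  define B where "B = sqrt (i / (pi * s\<^sup>2))"
  have sub: "ball x s \<subseteq> ball z (r + s)" if "norm (z - x) = r" for x
  proof
    fix y assume "y \<in> ball x s"
    then show "y \<in> ball z (r + s)"
      using dist_triangle[of z y x] that by (simp add: dist_norm)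
  qed
  have "norm (f x) \<le> B" if x: "norm (z - x) = r" for x
  proof -
    have "ennreal (pi * s\<^sup>2 * cmod ((f x)\<^sup>2)) \<le> (\<integral>\<^sup>+u\<in>ball x s. ennreal (cmod ((f u)\<^sup>2)) \<partial>lborel)"
      using sub[OF x] f s
      by (intro area_mean_value_inequality holomorphic_intros) (auto intro: holomorphic_on_subset)
    also have "\<dots> \<le> ?I"
      using sub[OF x] by (intro nn_integral_mono) (auto simp: indicator_def norm_power)
    finally have "pi * s\<^sup>2 * (cmod (f x))\<^sup>2 \<le> i"
      using real by (simp add: norm_power)
    then have "(cmod (f x))\<^sup>2 \<le> i / (pi * s\<^sup>2)"
      using s by (simp add: field_simps)
    then show ?thesis
      unfolding B_def by (rule real_le_rsqrt)
  qed
  moreover have "cball z r \<subseteq> ball z (r + s)"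
    using s by auto
  ultimately have "norm ((deriv ^^ n) f z) \<le> fact n * B / r ^ n"
    using f r s
    by (intro Cauchy_inequality holomorphic_on_imp_continuous_on)
       (auto intro: holomorphic_on_subset)
  then have "(norm ((deriv ^^ n) f z))\<^sup>2 \<le> (fact n * B / r ^ n)\<^sup>2"
    by (rule power_mono) simp
  also have "\<dots> = ?c * i"
    using real s by (simp add: B_def power_mult_distrib power_divide)
  finally show ?thesis
    using real by (simp add: ennreal_leI flip: ennreal_mult)
qed

section \<open>Averaging over disks of the Whitney scale\<close>

text \<open>The area element divided by the squared distance to the boundary is comparable to the invariant
  (hyperbolic) area of the disk, for which the disks \<open>\<bar>w - z\<bar> < e (1 - \<bar>w\<bar>)\<close> have size bounded above and
  below. The two bounds below replace a covering of the disk with bounded overlap: averaging over \<open>w\<close>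
  against this weight plays the role of the sum over the covering.\<close>

lemma whitney_weight_lower:
  assumes e: "0 < e" "e < 1" and z: "cmod z < 1"
  shows "ennreal (pi * (e / (1 + e))\<^sup>2 / 4)
    \<le> (\<integral>\<^sup>+w. ennreal (1 / (1 - cmod w)\<^sup>2) * of_bool (dist w z < e * (1 - cmod w)) \<partial>lborel)"
proof -
  define d where "d = 1 - cmod z"
  define a where "a = e / (1 + e)"
  have d: "d > 0" using z by (simp add: d_def)
  have a: "a > 0" "a < 1" "a = e * (1 - a)"
    using e by (simp_all add: a_def field_simps)
  \<comment> \<open>\<open>a\<close> solves \<open>a = e (1 - a)\<close>, so a point within \<open>a d\<close> of \<open>z\<close> satisfies the constraint of the integral.\<close>
  have "ennreal (pi * a\<^sup>2 / 4) = (\<integral>\<^sup>+w\<in>ball z (a * d). ennreal (1 / (2 * d)\<^sup>2) \<partial>lborel)"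
    using d a by (subst nn_integral_cmult_indicator)
      (simp_all add: emeasure_ball unit_ball_vol_2 power2_eq_square flip: ennreal_mult)
  also have "\<dots> \<le> (\<integral>\<^sup>+w. ennreal (1 / (1 - cmod w)\<^sup>2) * of_bool (dist w z < e * (1 - cmod w)) \<partial>lborel)"
  proof (rule nn_integral_mono)
    fix w :: complex
    show "ennreal (1 / (2 * d)\<^sup>2) * indicator (ball z (a * d)) w
      \<le> ennreal (1 / (1 - cmod w)\<^sup>2) * of_bool (dist w z < e * (1 - cmod w))"
    proof (cases "w \<in> ball z (a * d)")
      case True
      then have near: "dist w z < a * d"
        by (simp add: dist_commute)
      have "\<bar>cmod w - cmod z\<bar> \<le> dist w z"
        by (simp add: dist_norm norm_triangle_ineq3)
      then have b: "d - dist w z \<le> 1 - cmod w" "1 - cmod w \<le> d + dist w z"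
        by (auto simp: d_def)
      have "a * d < 1 * d" using a d by (intro mult_strict_right_mono) auto
      have pos: "0 < 1 - cmod w" and up: "1 - cmod w \<le> 2 * d"
        using b near \<open>a * d < 1 * d\<close> by linarith+
      have "(1 - a) * d < 1 - cmod w"
        using b near by (simp add: algebra_simps)
      then have "e * ((1 - a) * d) < e * (1 - cmod w)"
        using e by simp
      then have "dist w z < e * (1 - cmod w)"
        using near a(3) by (simp add: mult.assoc[symmetric])
      moreover have "1 / (2 * d)\<^sup>2 \<le> 1 / (1 - cmod w)\<^sup>2"
        using pos up by (intro divide_left_mono power_mono) auto
      ultimately show ?thesis by (simp add: indicator_def ennreal_leI)
    qed simp
  qed
  finally show ?thesis by (simp add: a_def)
qed

lemma whitney_weight_upper:
  assumes e: "0 < e" "e < 1"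
  shows "(\<integral>\<^sup>+w. ennreal (1 / (1 - cmod w)\<^sup>2) * of_bool (dist w z < e * (1 - cmod w)) \<partial>lborel)
    \<le> ennreal (4 * pi * (e / (1 - e))\<^sup>2)"
proof (cases "cmod z < 1")
  case True
  define d where "d = 1 - cmod z"
  define a where "a = e / (1 - e)"
  have d: "d > 0" using True by (simp add: d_def)
  have a: "a > 0" using e by (simp_all add: a_def field_simps)
  have "(\<integral>\<^sup>+w. ennreal (1 / (1 - cmod w)\<^sup>2) * of_bool (dist w z < e * (1 - cmod w)) \<partial>lborel)
     \<le> (\<integral>\<^sup>+w\<in>ball z (a * d). ennreal (4 / d\<^sup>2) \<partial>lborel)"
  proof (rule nn_integral_mono)
    fix w :: complex
    show "ennreal (1 / (1 - cmod w)\<^sup>2) * of_bool (dist w z < e * (1 - cmod w))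
      \<le> ennreal (4 / d\<^sup>2) * indicator (ball z (a * d)) w"
    proof (cases "dist w z < e * (1 - cmod w)")
      case near: True
      have "\<bar>cmod w - cmod z\<bar> \<le> dist w z"
        by (simp add: dist_norm norm_triangle_ineq3)
      then have b: "d - dist w z \<le> 1 - cmod w" "1 - cmod w \<le> d + dist w z"
        by (auto simp: d_def)
      have pos: "0 < 1 - cmod w"
        using near e zero_le_dist[of w z] by (smt (verit) mult_nonneg_nonpos)
      have "e * (1 - cmod w) < 1 * (1 - cmod w)"
        using pos e by (intro mult_strict_right_mono) auto
      with near have "dist w z < 1 - cmod w"
        by simp
      then have low: "d / 2 \<le> 1 - cmod w"
        using b by linarith
      have "(1 - cmod w) * (1 - e) < d"
        using b near by (simp add: algebra_simps)
      then have "1 - cmod w < d / (1 - e)"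
        using e by (simp add: field_simps)
      then have "e * (1 - cmod w) < a * d"
        using mult_strict_left_mono[OF _ e(1)] by (fastforce simp: a_def)
      then have "w \<in> ball z (a * d)"
        using near by (simp add: dist_commute)
      moreover have "1 / (1 - cmod w)\<^sup>2 \<le> 1 / (d / 2)\<^sup>2"
        using low pos d by (intro divide_left_mono power_mono) auto
      ultimately show ?thesis
        using near by (simp add: indicator_def ennreal_leI power_divide)
    qed simp
  qed
  also have "\<dots> = ennreal (4 * pi * a\<^sup>2)"
    using d a by (subst nn_integral_cmult_indicator)
      (simp_all add: emeasure_ball unit_ball_vol_2 power2_eq_square flip: ennreal_mult)
  finally show ?thesis by (simp add: a_def)
next
  case False
  have "\<not> dist w z < e * (1 - cmod w)" for w
  proof
    assume near: "dist w z < e * (1 - cmod w)"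
    have pos: "0 < 1 - cmod w"
      using near e zero_le_dist[of w z] by (smt (verit) mult_nonneg_nonpos)
    have "e * (1 - cmod w) < 1 * (1 - cmod w)"
      using pos e by (intro mult_strict_right_mono) auto
    with near have "dist w z < 1 - cmod w"
      by simp
    moreover have "cmod z - cmod w \<le> dist w z"
      using norm_triangle_ineq2[of z w] by (simp add: dist_norm norm_minus_commute)
    ultimately show False using False by linarith
  qed
  then show ?thesis by simp
qed

section \<open>A Carleson embedding that is uniform in the orders of differentiation\<close>

text \<open>Here \<open>e\<close> is the relative radius of the disks used for averaging, and \<open>\<eta> = p + 2 e\<close> that of the disks
  that carry the Cauchy estimates. The choice of \<open>e\<close> makes \<open>\<eta> < 1\<close>. The value is the quotient of the
  upper and lower constants of the two weight estimates, divided by the \<open>2 \<pi> e\<^sup>2\<close> of the mean value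
  inequality.\<close>

definition carleson_const :: "real \<Rightarrow> real" where
  "carleson_const p = (let e = (1 - p) / 3; \<eta> = (2 + p) / 3 in
     4 * pi * (\<eta> / (1 - \<eta>))\<^sup>2 / (2 * pi * e\<^sup>2 * (pi * (e / (1 + e))\<^sup>2 / 4)))"

lemma carleson_const_pos: "0 < p \<Longrightarrow> p < 1 \<Longrightarrow> carleson_const p > 0"
  unfolding carleson_const_def Let_def
  by (intro divide_pos_pos mult_pos_pos zero_less_power add_pos_pos) auto

text \<open>The estimate is uniform for \<open>z\<close> in a small disk around \<open>w\<close>, with \<open>d = 1 - \<bar>w\<bar>\<close> instead of \<open>1 - \<bar>z\<bar>\<close>
  as the length scale. The radius of the Cauchy estimate is \<open>p d\<close>, and \<open>e d\<close> is the one of the mean value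
  inequality, so all disks stay inside the disk of radius \<open>e d + p d + e d = (2 + p) / 3 * d\<close> around \<open>w\<close>.
  The geometric mean of the two area integrals is replaced by their arithmetic mean, which makes the
  bound additive in \<open>f\<close> and \<open>g\<close>; homogeneity restores the product later.\<close>

lemma higher_deriv_product_bound:
  assumes p: "0 < p" "p < 1" and w: "cmod w < 1" and z: "dist w z < (1 - p) / 3 * (1 - cmod w)"
    and f: "f holomorphic_on ball 0 1" "f \<in> borel_measurable borel"
    and g: "g holomorphic_on ball 0 1" "g \<in> borel_measurable borel"
  shows "ennreal (cmod ((deriv ^^ l) f z) * cmod ((deriv ^^ j) g z))
    \<le> ennreal (fact l * fact j / ((p * (1 - cmod w)) ^ (l + j) * (2 * pi * ((1 - p) / 3)\<^sup>2 * (1 - cmod w)\<^sup>2)))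
      * ((\<integral>\<^sup>+u\<in>ball w ((2 + p) / 3 * (1 - cmod w)). ennreal ((cmod (f u))\<^sup>2) \<partial>lborel)
       + (\<integral>\<^sup>+u\<in>ball w ((2 + p) / 3 * (1 - cmod w)). ennreal ((cmod (g u))\<^sup>2) \<partial>lborel))"
    (is "_ \<le> ennreal ?c * (?F + ?G)")
proof (cases "?F + ?G")
  case top
  have "ennreal ?c * (?F + ?G) = top"
    unfolding top using p w by (simp add: ennreal_mult_top)
  then show ?thesis by (metis top_greatest)
next
  case (real i)
  define d where "d = 1 - cmod w"
  define e where "e = (1 - p) / 3"
  have d: "d > 0" and e: "e > 0" using p w by (auto simp: d_def e_def)
  have "?F \<noteq> top" "?G \<noteq> top" using real by auto
  then obtain F G where FG: "?F = ennreal F" "F \<ge> 0" "?G = ennreal G" "G \<ge> 0"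
    by (cases ?F; cases ?G) simp_all
  have sub: "ball z (p * d + e * d) \<subseteq> ball w ((2 + p) / 3 * d)"
  proof
    fix y assume "y \<in> ball z (p * d + e * d)"
    then have "dist w y < e * d + (p * d + e * d)"
      using dist_triangle[of w y z] z by (simp add: d_def e_def)
    also have "\<dots> = (2 + p) / 3 * d" by (simp add: e_def field_simps)
    finally show "y \<in> ball w ((2 + p) / 3 * d)" by simp
  qed
  have "(2 + p) / 3 * d \<le> 1 * d"
    using d p by (intro mult_right_mono) auto
  then have sub1: "ball w ((2 + p) / 3 * d) \<subseteq> ball 0 1"
    by (simp add: ball_subset_ball_iff d_def)
  have bound: "(cmod ((deriv ^^ n) h z))\<^sup>2 \<le> (fact n / (p * d) ^ n)\<^sup>2 / (pi * (e * d)\<^sup>2) * H"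
    if h: "h holomorphic_on ball 0 1" "h \<in> borel_measurable borel"
      and H: "(\<integral>\<^sup>+u\<in>ball w ((2 + p) / 3 * d). ennreal ((cmod (h u))\<^sup>2) \<partial>lborel) = ennreal H" "H \<ge> 0" for h n H
  proof -
    have "ennreal ((cmod ((deriv ^^ n) h z))\<^sup>2) \<le> ennreal ((fact n / (p * d) ^ n)\<^sup>2 / (pi * (e * d)\<^sup>2))
       * (\<integral>\<^sup>+u\<in>ball z (p * d + e * d). ennreal ((cmod (h u))\<^sup>2) \<partial>lborel)"
      using p d e sub sub1 h by (intro higher_deriv_area_bound) (auto intro: holomorphic_on_subset)
    also have "\<dots> \<le> ennreal ((fact n / (p * d) ^ n)\<^sup>2 / (pi * (e * d)\<^sup>2)) * ennreal H"
      unfolding H(1)[symmetric] using sub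
      by (intro mult_left_mono nn_integral_mono) (auto simp: indicator_def)
    finally show ?thesis
      using H(2) by (simp flip: ennreal_mult)
  qed
  define a where "a = fact l / (p * d) ^ l"
  define b where "b = fact j / (p * d) ^ j"
  have ab: "a > 0" "b > 0" using p d by (auto simp: a_def b_def)
  define X where "X = cmod ((deriv ^^ l) f z) / a"
  define Y where "Y = cmod ((deriv ^^ j) g z) / b"
  have X: "X\<^sup>2 \<le> F / (pi * (e * d)\<^sup>2)"
  proof -
    have "(cmod ((deriv ^^ l) f z))\<^sup>2 \<le> a\<^sup>2 / (pi * (e * d)\<^sup>2) * F"
      unfolding a_def using FG by (intro bound f) (auto simp: d_def)
    then show ?thesis
      using ab by (simp add: X_def power_divide divide_le_eq mult_ac)
  qed
  have Y: "Y\<^sup>2 \<le> G / (pi * (e * d)\<^sup>2)"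
  proof -
    have "(cmod ((deriv ^^ j) g z))\<^sup>2 \<le> b\<^sup>2 / (pi * (e * d)\<^sup>2) * G"
      unfolding b_def using FG by (intro bound g) (auto simp: d_def)
    then show ?thesis
      using ab by (simp add: Y_def power_divide divide_le_eq mult_ac)
  qed
  have "cmod ((deriv ^^ l) f z) * cmod ((deriv ^^ j) g z) = a * b * (X * Y)"
    using ab by (simp add: X_def Y_def)
  also have "\<dots> \<le> a * b * ((F / (pi * (e * d)\<^sup>2) + G / (pi * (e * d)\<^sup>2)) / 2)"
    using ab X Y sum_squares_bound[of X Y] by (intro mult_left_mono) auto
  also have "\<dots> = ?c * (F + G)"
    using p d e
    by (simp add: a_def b_def d_def[symmetric] e_def[symmetric] power_add power_mult_distrib field_simps)
  finally have le: "cmod ((deriv ^^ l) f z) * cmod ((deriv ^^ j) g z) \<le> ?c * (F + G)" .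
  have "?c \<ge> 0" using p w by simp
  then have "ennreal ?c * (?F + ?G) = ennreal (?c * (F + G))"
    unfolding FG(1,3) ennreal_plus[OF FG(2,4), symmetric]
    using FG(2,4) by (intro ennreal_mult[symmetric] add_nonneg_nonneg)
  then show ?thesis
    using ennreal_leI[OF le] by (simp only:)
qed

text \<open>This is the Carleson measure estimate behind the theorem. The integral against \<open>P\<close> is averaged over
  small disks with centre \<open>w\<close>. On one such disk the derivatives contribute \<open>(p d) ^ (- (l + j)) / d\<^sup>2\<close> and
  the measure contributes \<open>K d ^ (l + j + 2) p ^ (l + j)\<close>, so that all powers of \<open>p\<close> and \<open>d\<close> cancel and
  what remains is a local area integral of \<open>\<bar>f\<bar>\<^sup>2 + \<bar>g\<bar>\<^sup>2\<close>. Integrating over \<open>w\<close> gives back the full area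
  integrals with a factor that does not depend on \<open>l\<close> and \<open>j\<close>.\<close>

lemma carleson_embedding:
  fixes P :: "complex measure"
  assumes p: "0 < p" "p < 1" and K: "K \<ge> 0"
    and P: "sets P = sets (restrict_space borel (ball 0 1))" "sigma_finite_measure P"
    and bound: "\<And>w. cmod w < 1 \<Longrightarrow>
      emeasure P (ball w (1 / 2 * (1 - cmod w))) \<le> ennreal (K * (1 - cmod w) ^ (l + j + 2) * p ^ (l + j))"
    and f: "f holomorphic_on ball 0 1" "f \<in> borel_measurable borel"
    and g: "g holomorphic_on ball 0 1" "g \<in> borel_measurable borel"
  shows "(\<integral>\<^sup>+z. ennreal (cmod ((deriv ^^ l) f z) * cmod ((deriv ^^ j) g z)) \<partial>P)
    \<le> ennreal (K * fact l * fact j * carleson_const p)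
      * ((\<integral>\<^sup>+u\<in>ball 0 1. ennreal ((cmod (f u))\<^sup>2) \<partial>lborel) + (\<integral>\<^sup>+u\<in>ball 0 1. ennreal ((cmod (g u))\<^sup>2) \<partial>lborel))"
proof -
  define e where "e = (1 - p) / 3"
  define \<eta> where "\<eta> = (2 + p) / 3"
  define \<kappa> where "\<kappa> = pi * (e / (1 + e))\<^sup>2 / 4"
  define \<kappa>' where "\<kappa>' = 4 * pi * (\<eta> / (1 - \<eta>))\<^sup>2"
  have e: "0 < e" "e < 1 / 2" and \<eta>: "0 < \<eta>" "\<eta> < 1"
    using p by (auto simp: e_def \<eta>_def)
  then have \<kappa>: "\<kappa> > 0" and \<kappa>': "\<kappa>' > 0"
    by (auto simp: \<kappa>_def \<kappa>'_def intro!: divide_pos_pos mult_pos_pos zero_less_power)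
  interpret P: sigma_finite_measure P by (rule P)
  interpret pair_sigma_finite P lborel ..
  have spP: "space P = ball 0 1"
    using sets_eq_imp_space_eq[OF P(1)] by (simp add: space_restrict_space)
  have kernel: "(\<lambda>w. ennreal (1 / (1 - cmod w)\<^sup>2) * of_bool (dist w z < e * (1 - cmod w))) \<in> borel_measurable lborel"
    for z :: complex
    by measurable
  have id[measurable]: "(\<lambda>z. z) \<in> P \<rightarrow>\<^sub>M borel"
    by (subst measurable_cong_sets[OF P(1) refl]) (simp add: measurable_restrict_space1)
  define \<phi> where "\<phi> z = ennreal (cmod ((deriv ^^ l) f z) * cmod ((deriv ^^ j) g z))" for z
  have \<phi>_meas[measurable]: "\<phi> \<in> borel_measurable P"
  proof -
    have "continuous_on (ball 0 1) (\<lambda>z. cmod ((deriv ^^ l) f z) * cmod ((deriv ^^ j) g z))"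
      using f g by (intro continuous_intros holomorphic_on_imp_continuous_on holomorphic_higher_deriv) auto
    then have "(\<lambda>z. cmod ((deriv ^^ l) f z) * cmod ((deriv ^^ j) g z)) \<in> borel_measurable P"
      by (subst measurable_cong_sets[OF P(1) refl]) (rule borel_measurable_continuous_on_restrict)
    then show ?thesis unfolding \<phi>_def by measurable
  qed
  define N where "N w z = (of_bool (dist w z < e * (1 - cmod w)) :: ennreal)" for w z :: complex
  define \<Phi> where "\<Phi> h w = (\<integral>\<^sup>+u. (ennreal ((cmod (h u))\<^sup>2) * indicator (ball 0 1) u) * of_bool (dist w u < \<eta> * (1 - cmod w)) \<partial>lborel)"
    for h :: "complex \<Rightarrow> complex" and w
  define I where "I h = (\<integral>\<^sup>+u\<in>ball 0 1. ennreal ((cmod (h u))\<^sup>2) \<partial>lborel)" for h :: "complex \<Rightarrow> complex"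
  have [measurable]: "(indicator (ball 0 1) :: complex \<Rightarrow> ennreal) \<in> borel_measurable borel"
    by (intro borel_measurable_indicator) simp
  have I_bound: "(\<integral>\<^sup>+w. ennreal (1 / (1 - cmod w)\<^sup>2) * \<Phi> h w \<partial>lborel) \<le> ennreal \<kappa>' * I h"
    and \<Phi>_meas: "\<Phi> h \<in> borel_measurable borel"
    if [measurable]: "h \<in> borel_measurable borel" for h
  proof -
    show "\<Phi> h \<in> borel_measurable borel"
      unfolding \<Phi>_def by measurable
    have "(\<integral>\<^sup>+w. ennreal (1 / (1 - cmod w)\<^sup>2) * \<Phi> h w \<partial>lborel)
       = (\<integral>\<^sup>+w. (\<integral>\<^sup>+u. (ennreal ((cmod (h u))\<^sup>2) * indicator (ball 0 1) u)
            * (ennreal (1 / (1 - cmod w)\<^sup>2) * of_bool (dist w u < \<eta> * (1 - cmod w))) \<partial>lborel) \<partial>lborel)"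
      unfolding \<Phi>_def by (subst nn_integral_cmult[symmetric]) (auto simp: mult_ac)
    also have "\<dots> = (\<integral>\<^sup>+u. (\<integral>\<^sup>+w. (ennreal ((cmod (h u))\<^sup>2) * indicator (ball 0 1) u)
            * (ennreal (1 / (1 - cmod w)\<^sup>2) * of_bool (dist w u < \<eta> * (1 - cmod w))) \<partial>lborel) \<partial>lborel)"
      by (rule lborel_pair.Fubini') measurable
    also have "\<dots> \<le> (\<integral>\<^sup>+u. (ennreal ((cmod (h u))\<^sup>2) * indicator (ball 0 1) u) * ennreal \<kappa>' \<partial>lborel)"
    proof (rule nn_integral_mono)
      fix u :: complex
      show "(\<integral>\<^sup>+w. (ennreal ((cmod (h u))\<^sup>2) * indicator (ball 0 1) u)
            * (ennreal (1 / (1 - cmod w)\<^sup>2) * of_bool (dist w u < \<eta> * (1 - cmod w))) \<partial>lborel)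
        \<le> (ennreal ((cmod (h u))\<^sup>2) * indicator (ball 0 1) u) * ennreal \<kappa>'"
        using whitney_weight_upper[OF \<eta>, of u]
        by (subst nn_integral_cmult) (auto simp: \<kappa>'_def intro!: mult_left_mono)
    qed
    also have "\<dots> = ennreal \<kappa>' * I h"
      unfolding I_def by (subst nn_integral_multc) (auto simp: mult.commute)
    finally show "(\<integral>\<^sup>+w. ennreal (1 / (1 - cmod w)\<^sup>2) * \<Phi> h w \<partial>lborel) \<le> ennreal \<kappa>' * I h" .
  qed
  note [measurable] = \<Phi>_meas[OF f(2)] \<Phi>_meas[OF g(2)]
  \<comment> \<open>what is left of the constants after the powers of \<open>p\<close> and \<open>d\<close> have cancelled\<close>
  define c where "c = K * fact l * fact j / (2 * pi * e\<^sup>2)"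
  have c: "c \<ge> 0" using K by (simp add: c_def)
  have inner: "(\<integral>\<^sup>+z. \<phi> z * (ennreal (1 / (1 - cmod w)\<^sup>2) * N w z) \<partial>P)
      \<le> ennreal c * (ennreal (1 / (1 - cmod w)\<^sup>2) * \<Phi> f w + ennreal (1 / (1 - cmod w)\<^sup>2) * \<Phi> g w)" for w
  proof (cases "cmod w < 1")
    case False
    then have "e * (1 - cmod w) \<le> 0" using e by (simp add: mult_nonneg_nonpos)
    then have "N w z = 0" for z
      using zero_le_dist[of w z] by (simp add: N_def not_less order_trans)
    then show ?thesis by simp
  next
    case w: True
    define d where "d = 1 - cmod w"
    have d: "d > 0" using w by (simp add: d_def)
    have "\<eta> * d \<le> 1 * d" using d \<eta> by (intro mult_right_mono) auto
    then have sub1: "ball w (\<eta> * d) \<subseteq> ball 0 1"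
      by (simp add: ball_subset_ball_iff d_def)
    have \<Phi>_eq: "\<Phi> h w = (\<integral>\<^sup>+u\<in>ball w (\<eta> * d). ennreal ((cmod (h u))\<^sup>2) \<partial>lborel)" for h
      unfolding \<Phi>_def using sub1 by (intro nn_integral_cong) (auto simp: indicator_def d_def)
    define C where "C = fact l * fact j / ((p * d) ^ (l + j) * (2 * pi * e\<^sup>2 * d\<^sup>2))"
    have C: "C \<ge> 0" using p d by (simp add: C_def)
    have "e * d < 1 / 2 * d" using d e by (intro mult_strict_right_mono) auto
    then have sub2: "ball w (e * d) \<subseteq> ball w (1 / 2 * d)" by auto
    have sub3: "ball w (1 / 2 * d) \<subseteq> ball 0 1"
      using d by (simp add: ball_subset_ball_iff d_def field_simps)
    have in_P: "ball w (e * d) \<in> sets P" "ball w (1 / 2 * d) \<in> sets P"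
      unfolding P(1) using sub2 sub3 by (auto simp: sets_restrict_space_iff)
    have "(\<integral>\<^sup>+z. \<phi> z * (ennreal (1 / (1 - cmod w)\<^sup>2) * N w z) \<partial>P)
        \<le> (\<integral>\<^sup>+z. (ennreal (1 / d\<^sup>2) * (ennreal C * (\<Phi> f w + \<Phi> g w))) * indicator (ball w (e * d)) z \<partial>P)"
    proof (rule nn_integral_mono)
      fix z
      show "\<phi> z * (ennreal (1 / (1 - cmod w)\<^sup>2) * N w z)
        \<le> (ennreal (1 / d\<^sup>2) * (ennreal C * (\<Phi> f w + \<Phi> g w))) * indicator (ball w (e * d)) z"
      proof (cases "dist w z < e * d")
        case True
        then have "\<phi> z \<le> ennreal C * (\<Phi> f w + \<Phi> g w)"
          unfolding \<phi>_def \<Phi>_eq C_def d_def e_def \<eta>_def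
          using p w f g by (intro higher_deriv_product_bound) auto
        then have "\<phi> z * ennreal (1 / d\<^sup>2) \<le> (ennreal C * (\<Phi> f w + \<Phi> g w)) * ennreal (1 / d\<^sup>2)"
          by (rule mult_right_mono) simp
        then show ?thesis
          using True by (simp add: N_def d_def mult_ac)
      next
        case False
        then show ?thesis by (simp add: N_def d_def)
      qed
    qed
    also have "\<dots> = (ennreal (1 / d\<^sup>2) * (ennreal C * (\<Phi> f w + \<Phi> g w))) * emeasure P (ball w (e * d))"
      using in_P by (simp add: nn_integral_cmult_indicator)
    also have "\<dots> \<le> (ennreal (1 / d\<^sup>2) * (ennreal C * (\<Phi> f w + \<Phi> g w))) * ennreal (K * d ^ (l + j + 2) * p ^ (l + j))"
      using bound[OF w] emeasure_mono[OF sub2 in_P(2)]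
      by (intro mult_left_mono) (auto simp: d_def intro: order_trans)
    also have "\<dots> = ennreal (1 / d\<^sup>2) * ennreal (C * (K * d ^ (l + j + 2) * p ^ (l + j))) * (\<Phi> f w + \<Phi> g w)"
      using C K d p by (simp add: ennreal_mult mult_ac)
    also have "C * (K * d ^ (l + j + 2) * p ^ (l + j)) = c"
      using d p e by (simp add: C_def c_def power_add power_mult_distrib power2_eq_square field_simps)
    finally show ?thesis
      by (simp only: d_def distrib_left distrib_right mult_ac)
  qed
  have "ennreal \<kappa> * (\<integral>\<^sup>+z. \<phi> z \<partial>P) = (\<integral>\<^sup>+z. ennreal \<kappa> * \<phi> z \<partial>P)"
    by (simp add: nn_integral_cmult)
  also have "\<dots> \<le> (\<integral>\<^sup>+z. (\<integral>\<^sup>+w. \<phi> z * (ennreal (1 / (1 - cmod w)\<^sup>2) * N w z) \<partial>lborel) \<partial>P)"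
  proof (rule nn_integral_mono)
    fix z assume "z \<in> space P"
    then have z: "cmod z < 1" by (simp add: spP)
    have "\<phi> z * ennreal \<kappa> \<le> \<phi> z * (\<integral>\<^sup>+w. ennreal (1 / (1 - cmod w)\<^sup>2) * N w z \<partial>lborel)"
      unfolding \<kappa>_def N_def using e z by (intro mult_left_mono whitney_weight_lower) auto
    also have "\<dots> = (\<integral>\<^sup>+w. \<phi> z * (ennreal (1 / (1 - cmod w)\<^sup>2) * N w z) \<partial>lborel)"
      unfolding N_def using kernel by (rule nn_integral_cmult[symmetric])
    finally show "ennreal \<kappa> * \<phi> z \<le> \<dots>" by (simp add: mult.commute)
  qed
  also have "\<dots> = (\<integral>\<^sup>+w. (\<integral>\<^sup>+z. \<phi> z * (ennreal (1 / (1 - cmod w)\<^sup>2) * N w z) \<partial>P) \<partial>lborel)"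
    unfolding N_def by (rule Fubini'[symmetric]) measurable
  also have "\<dots> \<le> (\<integral>\<^sup>+w. ennreal c * (ennreal (1 / (1 - cmod w)\<^sup>2) * \<Phi> f w + ennreal (1 / (1 - cmod w)\<^sup>2) * \<Phi> g w) \<partial>lborel)"
    by (intro nn_integral_mono inner)
  also have "\<dots> = ennreal c * ((\<integral>\<^sup>+w. ennreal (1 / (1 - cmod w)\<^sup>2) * \<Phi> f w \<partial>lborel) + (\<integral>\<^sup>+w. ennreal (1 / (1 - cmod w)\<^sup>2) * \<Phi> g w \<partial>lborel))"
    by (simp add: nn_integral_cmult nn_integral_add)
  also have "\<dots> \<le> ennreal c * (ennreal \<kappa>' * I f + ennreal \<kappa>' * I g)"
    using f g by (intro mult_left_mono add_mono I_bound) auto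
  finally have "ennreal (1 / \<kappa>) * (ennreal \<kappa> * (\<integral>\<^sup>+z. \<phi> z \<partial>P)) \<le> ennreal (1 / \<kappa>) * (ennreal c * (ennreal \<kappa>' * I f + ennreal \<kappa>' * I g))"
    by (rule mult_left_mono) simp
  also have "ennreal (1 / \<kappa>) * (ennreal \<kappa> * (\<integral>\<^sup>+z. \<phi> z \<partial>P)) = (\<integral>\<^sup>+z. \<phi> z \<partial>P)"
    using \<kappa> by (simp add: mult.assoc[symmetric] flip: ennreal_mult)
  also have "ennreal (1 / \<kappa>) * (ennreal c * (ennreal \<kappa>' * I f + ennreal \<kappa>' * I g)) = ennreal (1 / \<kappa> * c * \<kappa>') * (I f + I g)"
  proof -
    have "ennreal (1 / \<kappa> * c * \<kappa>') = ennreal (1 / \<kappa>) * ennreal c * ennreal \<kappa>'"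
      using \<kappa> c \<kappa>' by (simp only: ennreal_mult divide_nonneg_pos zero_le_one mult_nonneg_nonneg less_imp_le)
    then show ?thesis by (simp only: distrib_left mult_ac)
  qed
  also have "1 / \<kappa> * c * \<kappa>' = K * fact l * fact j * carleson_const p"
  proof -
    have "carleson_const p = \<kappa>' / (2 * pi * e\<^sup>2 * \<kappa>)"
      unfolding carleson_const_def Let_def e_def \<eta>_def \<kappa>_def \<kappa>'_def ..
    then show ?thesis by (simp add: c_def mult_ac)
  qed
  finally show ?thesis
    by (simp add: \<phi>_def I_def)
qed

section \<open>The positive parts of a complex measure\<close>

lemma rc_borel_in_sets: "E \<in> rc_borel \<Longrightarrow> E \<in> sets (restrict_space borel (ball 0 1))"
  by (auto simp: rc_borel_def sets_restrict_space_iff)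

lemma cball_in_rc_borel: "cball z r \<subseteq> ball 0 1 \<Longrightarrow> cball z r \<in> rc_borel"
  unfolding rc_borel_def by (auto intro!: exI[of _ "cball z r"])

lemma ball_in_rc_borel: "cball z r \<subseteq> ball 0 1 \<Longrightarrow> ball z r \<in> rc_borel"
  unfolding rc_borel_def by (auto intro!: exI[of _ "cball z r"])

lemma sets_positive_variation: "sets (positive_variation \<nu>) = sets (restrict_space borel (ball 0 1))"
  unfolding positive_variation_def
  using sets.sets_measure_of_eq[of "restrict_space borel (ball (0::complex) 1)"]
  by (simp add: space_restrict_space)

lemma space_positive_variation: "space (positive_variation \<nu>) = ball 0 1"
  using sets_eq_imp_space_eq[OF sets_positive_variation] by (simp add: space_restrict_space)

text \<open>The partition of \<open>E\<close> into \<open>A\<close> and \<open>E - A\<close>, padded with empty sets, is one of those in the supremum.\<close>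

lemma cmod_le_variation:
  assumes A: "A \<in> rc_borel" and E: "E \<in> rc_borel" and AE: "A \<subseteq> E"
  shows "ennreal (cmod (\<mu> A)) \<le> variation \<mu> E"
proof -
  define B where "B = binaryset A (E - A)"
  have "E - A \<in> rc_borel" "{} \<in> rc_borel"
    using A E by (auto simp: rc_borel_def)
  then have "range B \<subseteq> rc_borel"
    using A by (auto simp: B_def binaryset_def)
  moreover have "disjoint_family B"
    by (auto simp: disjoint_family_on_def B_def binaryset_def)
  moreover have "(\<Union>i. B i) = E"
    using AE by (simp add: B_def UN_binaryset_eq Un_absorb1)
  ultimately have "(\<Sum>i. ennreal (cmod (\<mu> (B i)))) \<le> variation \<mu> E"
    unfolding variation_def by (intro SUP_upper[of B _ "\<lambda>A. \<Sum>i. ennreal (cmod (\<mu> (A i)))"]) simp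
  moreover have "(\<Sum>i\<in>{0}. ennreal (cmod (\<mu> (B i)))) \<le> (\<Sum>i. ennreal (cmod (\<mu> (B i))))"
    by (rule sum_le_suminf) auto
  moreover have "B 0 = A"
    by (simp add: B_def binaryset_def)
  ultimately show ?thesis
    by simp
qed

text \<open>The four measures by which the complex integral is defined are of this form with \<open>c\<close> equal to
  \<open>1\<close>, \<open>-1\<close>, \<open>-\<i>\<close>, \<open>\<i>\<close>. Through this bound the growth condition, which is stated for the variation,
  passes to measures with respect to which one can integrate.\<close>

lemma emeasure_positive_variation_le:
  assumes \<mu>: "disk_measure \<mu>" and c: "cmod c = 1" and E: "E \<in> rc_borel"
  shows "emeasure (positive_variation (\<lambda>A. Re (c * \<mu> A))) E \<le> variation \<mu> E"
proof -
  have "emeasure (positive_variation (\<lambda>A. Re (c * \<mu> A))) E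
     = (SUP A\<in>{A \<in> rc_borel. A \<subseteq> E}. ennreal (Re (c * \<mu> A)))"
  proof (rule emeasure_positive_variation)
    fix A :: "nat \<Rightarrow> complex set"
    assume "range A \<subseteq> rc_borel" "disjoint_family A" "(\<Union>i. A i) \<in> rc_borel"
    then have "(\<lambda>i. \<mu> (A i)) sums \<mu> (\<Union>i. A i)"
      using \<mu> by (simp add: disk_measure_def)
    then show "(\<lambda>i. Re (c * \<mu> (A i))) sums Re (c * \<mu> (\<Union>i. A i))"
      by (intro sums_Re sums_mult)
  qed (rule rc_borel_in_sets[OF E])
  also have "\<dots> \<le> variation \<mu> E"
  proof (rule SUP_least)
    fix A assume A: "A \<in> {A \<in> rc_borel. A \<subseteq> E}"
    have "Re (c * \<mu> A) \<le> cmod (\<mu> A)"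
      using complex_Re_le_cmod[of "c * \<mu> A"] c by (simp add: norm_mult)
    then have "ennreal (Re (c * \<mu> A)) \<le> ennreal (cmod (\<mu> A))"
      by (rule ennreal_leI)
    also have "\<dots> \<le> variation \<mu> E"
      using A E by (intro cmod_le_variation) auto
    finally show "ennreal (Re (c * \<mu> A)) \<le> variation \<mu> E" .
  qed
  finally show ?thesis .
qed

text \<open>Needed for exchanging integrals in the embedding; it is the point where the finiteness of the
  variation on compact sets enters.\<close>

lemma sigma_finite_positive_variation:
  assumes \<mu>: "disk_measure \<mu>" and c: "cmod c = 1"
  shows "sigma_finite_measure (positive_variation (\<lambda>A. Re (c * \<mu> A)))" (is "sigma_finite_measure ?P")
proof
  define K where "K n = cball (0::complex) (1 - 1 / real (Suc n))" for n
  have "1 - 1 / real (Suc n) < 1" for n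
    by simp
  then have K_sub: "K n \<subseteq> ball 0 1" for n
    unfolding K_def using mem_cball_0 mem_ball_0 le_less_trans by blast
  then have K: "K n \<in> rc_borel" for n
    unfolding K_def by (rule cball_in_rc_borel)
  have "emeasure ?P (K n) \<noteq> \<infinity>" for n
  proof -
    have "compact (K n)"
      by (simp add: K_def)
    then have "variation \<mu> (K n) < \<infinity>"
      using \<mu> K_sub by (simp add: disk_measure_def)
    then show ?thesis
      using le_less_trans[OF emeasure_positive_variation_le[OF \<mu> c K[of n]]] by auto
  qed
  moreover have "\<Union> (range K) = space ?P"
    unfolding space_positive_variation
  proof (intro subset_antisym subsetI)
    fix z :: complex assume "z \<in> ball 0 1"
    then have "0 < 1 - cmod z" by simp
    then obtain n where "inverse (real (Suc n)) < 1 - cmod z"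
      using reals_Archimedean by blast
    then have "z \<in> K n" by (simp add: K_def field_simps)
    then show "z \<in> \<Union> (range K)" by blast
  qed (use K_sub in blast)
  moreover have "range K \<subseteq> sets ?P"
    using K rc_borel_in_sets by (auto simp: sets_positive_variation)
  ultimately show "\<exists>A. countable A \<and> A \<subseteq> sets ?P \<and> \<Union> A = space ?P \<and> (\<forall>a\<in>A. emeasure ?P a \<noteq> \<infinity>)"
    by (intro exI[of _ "range K"]) auto
qed

section \<open>Completeness of the Bergman space\<close>

lemma fun_of_holomorphic: "fun_of f holomorphic_on ball 0 1"
  using fun_of[of f] by (simp add: bergman_carrier_def)

lemma borel_measurable_if_holomorphic_on_disk:
  assumes f: "f holomorphic_on ball 0 1" and 0: "\<And>z. z \<notin> ball 0 1 \<Longrightarrow> f z = 0"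
  shows "f \<in> borel_measurable borel"
proof -
  have "(\<lambda>z. indicator (ball 0 1) z *\<^sub>R f z) \<in> borel_measurable borel"
    by (intro borel_measurable_continuous_on_indicator holomorphic_on_imp_continuous_on f) simp
  also have "(\<lambda>z. indicator (ball 0 1) z *\<^sub>R f z) = f"
    using 0 by (auto simp: indicator_def fun_eq_iff)
  finally show ?thesis .
qed

lemma fun_of_measurable [measurable]: "fun_of f \<in> borel_measurable borel"
  using fun_of[of f] by (intro borel_measurable_if_holomorphic_on_disk) (auto simp: bergman_carrier_def)

lemma nn_integral_dV:
  assumes [measurable]: "h \<in> borel_measurable borel"
  shows "(\<integral>\<^sup>+z. h z \<partial>dV) = ennreal (1 / pi) * (\<integral>\<^sup>+z\<in>ball 0 1. h z \<partial>lborel)"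
proof -
  have h: "h \<in> borel_measurable (restrict_space lborel (ball 0 1))"
    by (intro measurable_restrict_space1) simp
  have "(\<integral>\<^sup>+z. h z \<partial>dV) = (\<integral>\<^sup>+z. ennreal (1 / pi) * h z \<partial>restrict_space lborel (ball 0 1))"
    unfolding dV_def using h by (subst nn_integral_density) auto
  also have "\<dots> = ennreal (1 / pi) * (\<integral>\<^sup>+z. h z \<partial>restrict_space lborel (ball 0 1))"
    using h by (rule nn_integral_cmult)
  also have "(\<integral>\<^sup>+z. h z \<partial>restrict_space lborel (ball 0 1)) = (\<integral>\<^sup>+z\<in>ball 0 1. h z \<partial>lborel)"
    by (rule nn_integral_restrict_space) simp
  finally show ?thesis .
qed

lemma nn_integral_dV_norm_bergman:
  "(\<integral>\<^sup>+z. ennreal ((cmod (fun_of f z))\<^sup>2) \<partial>dV) = ennreal ((norm f)\<^sup>2)"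
proof -
  have int: "integrable dV (\<lambda>z. (cmod (fun_of f z))\<^sup>2)"
    using fun_of[of f] by (simp add: bergman_carrier_def)
  show ?thesis
    by (subst nn_integral_eq_integral[OF int]) (auto simp: norm_bergman_eq)
qed

text \<open>The factor \<open>\<pi>\<close> undoes the normalization of the area measure in the Bergman norm.\<close>

lemma nn_integral_norm_bergman:
  "(\<integral>\<^sup>+z\<in>ball 0 1. ennreal ((cmod (fun_of f z))\<^sup>2) \<partial>lborel) = ennreal (pi * (norm f)\<^sup>2)"
proof -
  have "ennreal (1 / pi) * (\<integral>\<^sup>+z\<in>ball 0 1. ennreal ((cmod (fun_of f z))\<^sup>2) \<partial>lborel) = ennreal ((norm f)\<^sup>2)"
    unfolding nn_integral_dV_norm_bergman[symmetric] by (subst nn_integral_dV) simp_all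
  then have "ennreal pi * (ennreal (1 / pi) * (\<integral>\<^sup>+z\<in>ball 0 1. ennreal ((cmod (fun_of f z))\<^sup>2) \<partial>lborel))
      = ennreal (pi * (norm f)\<^sup>2)"
    by (simp add: ennreal_mult)
  then show ?thesis
    by (simp add: mult.assoc[symmetric] flip: ennreal_mult)
qed

lemma fun_of_minus: "fun_of (f - g) z = fun_of f z - fun_of g z"
  by (simp add: minus_bergman_def uminus_bergman_def plus_bergman.rep_eq bergman_scaleC.rep_eq)

lemma fun_of_outside: "z \<notin> ball 0 1 \<Longrightarrow> fun_of f z = 0"
  using fun_of[of f] by (simp add: bergman_carrier_def)

lemma bergman_point_evaluation:
  assumes z: "cmod z < 1"
  shows "cmod (fun_of f z) \<le> norm f / (1 - cmod z)"
proof -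
  define r where "r = 1 - cmod z"
  have r: "r > 0" using z by (simp add: r_def)
  have sub: "ball z r \<subseteq> ball 0 1"
    by (simp add: ball_subset_ball_iff r_def)
  have "ennreal (pi * r\<^sup>2 * cmod ((fun_of f z)\<^sup>2)) \<le> (\<integral>\<^sup>+u\<in>ball z r. ennreal (cmod ((fun_of f u)\<^sup>2)) \<partial>lborel)"
    using r sub fun_of_holomorphic
    by (intro area_mean_value_inequality holomorphic_intros) (auto intro: holomorphic_on_subset)
  also have "\<dots> \<le> (\<integral>\<^sup>+u\<in>ball 0 1. ennreal ((cmod (fun_of f u))\<^sup>2) \<partial>lborel)"
    using sub by (intro nn_integral_mono) (auto simp: indicator_def norm_power)
  also have "\<dots> = ennreal (pi * (norm f)\<^sup>2)"
    by (rule nn_integral_norm_bergman)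
  finally have "pi * r\<^sup>2 * (cmod (fun_of f z))\<^sup>2 \<le> pi * (norm f)\<^sup>2"
    by (simp add: norm_power)
  then have "(r * cmod (fun_of f z))\<^sup>2 \<le> (norm f)\<^sup>2"
    by (simp add: power_mult_distrib mult.assoc)
  then have "r * cmod (fun_of f z) \<le> norm f"
    by (rule power2_le_imp_le) simp
  then show ?thesis
    using r by (simp add: r_def field_simps)
qed

text \<open>Point evaluations are bounded, uniformly on compact sets, so a Cauchy sequence converges locally
  uniformly to a holomorphic function \<open>h\<close>. Fatou's lemma bounds the distance from the sequence to \<open>h\<close>,
  which shows both that \<open>h\<close> is square integrable and that the convergence holds in norm.\<close>

instance bergman :: complete_space
proof
  fix X :: "nat \<Rightarrow> bergman"
  assume X: "Cauchy X"
  define \<phi> where "\<phi> n = fun_of (X n)" for n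
  have diff: "cmod (\<phi> m z - \<phi> n z) \<le> norm (X m - X n) / (1 - cmod z)" if "cmod z < 1" for m n z
    using bergman_point_evaluation[OF that, of "X m - X n"] by (simp add: \<phi>_def fun_of_minus)
  have XN: "\<exists>N. \<forall>m\<ge>N. \<forall>n\<ge>N. norm (X m - X n) < e" if "e > 0" for e
    using X that by (simp add: Cauchy_iff)
  have unif: "\<exists>N. \<forall>m n z. N \<le> m \<and> N \<le> n \<and> cmod z \<le> R \<longrightarrow> dist (\<phi> m z) (\<phi> n z) < e"
    if "R < 1" "e > 0" for R e
  proof -
    have "e * (1 - R) > 0" using that by simp
    from XN[OF this] obtain N where N: "\<And>m n. m \<ge> N \<Longrightarrow> n \<ge> N \<Longrightarrow> norm (X m - X n) < e * (1 - R)"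
      by blast
    have "dist (\<phi> m z) (\<phi> n z) < e" if "N \<le> m" "N \<le> n" "cmod z \<le> R" for m n z
    proof -
      have "dist (\<phi> m z) (\<phi> n z) \<le> norm (X m - X n) / (1 - cmod z)"
        using diff[of z m n] that \<open>R < 1\<close> by (simp add: dist_norm)
      also have "\<dots> \<le> norm (X m - X n) / (1 - R)"
        using that \<open>R < 1\<close> by (intro divide_left_mono) auto
      also have "\<dots> < e"
        using N[OF that(1,2)] \<open>R < 1\<close> by (simp add: pos_divide_less_eq)
      finally show ?thesis .
    qed
    then show ?thesis by blast
  qed
  define h where "h z = lim (\<lambda>n. \<phi> n z)" for z
  have lim: "(\<lambda>n. \<phi> n z) \<longlonglongrightarrow> h z" for z
  proof (cases "cmod z < 1")
    case True
    have "Cauchy (\<lambda>n. \<phi> n z)"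
      unfolding Cauchy_def using unif[OF True] by blast
    then show ?thesis
      unfolding h_def by (simp add: Cauchy_convergent_iff convergent_LIMSEQ_iff)
  next
    case False
    then show ?thesis by (simp add: h_def \<phi>_def fun_of_outside)
  qed
  have h_out: "h z = 0" if "z \<notin> ball 0 1" for z
    using that by (simp add: h_def \<phi>_def fun_of_outside)
  have hol: "h holomorphic_on ball 0 1"
  proof (rule holomorphic_uniform_sequence[where f = \<phi>])
    fix x :: complex assume "x \<in> ball 0 1"
    then have x: "cmod x < 1" by simp
    define d where "d = (1 - cmod x) / 2"
    define R where "R = cmod x + d"
    have "d > 0" "R < 1" using x by (simp_all add: d_def R_def field_simps)
    have le_R: "cmod z \<le> R" if "z \<in> cball x d" for z
      using that norm_triangle_ineq2[of z x] by (simp add: R_def dist_norm norm_minus_commute)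
    have "uniform_limit (cball x d) \<phi> h sequentially"
    proof (rule uniform_limitI)
      fix e :: real assume "e > 0"
      have "\<exists>N. \<forall>n z. N \<le> n \<and> cmod z \<le> R \<longrightarrow> dist (\<phi> n z) (h z) < e"
        using uniformly_cauchy_imp_uniformly_convergent[of "\<lambda>z. cmod z \<le> R" \<phi> h]
          unif[OF \<open>R < 1\<close>] lim \<open>e > 0\<close> unfolding lim_sequentially by blast
      then show "\<forall>\<^sub>F n in sequentially. \<forall>z\<in>cball x d. dist (\<phi> n z) (h z) < e"
        unfolding eventually_sequentially using le_R by blast
    qed
    then show "\<exists>d>0. cball x d \<subseteq> ball 0 1 \<and> uniform_limit (cball x d) \<phi> h sequentially"
      using \<open>d > 0\<close> le_R \<open>R < 1\<close> by (intro exI[of _ d]) force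
  qed (simp_all add: \<phi>_def fun_of_holomorphic)
  have [measurable]: "h \<in> borel_measurable borel"
    using hol h_out by (rule borel_measurable_if_holomorphic_on_disk)
  have [measurable]: "\<phi> n \<in> borel_measurable borel" for n
    by (simp add: \<phi>_def)
  have id_dV [measurable]: "(\<lambda>z. z) \<in> dV \<rightarrow>\<^sub>M borel"
    by (subst measurable_cong_sets[OF sets_dV refl]) (simp add: measurable_restrict_space1)
  have dV_meas: "g \<in> borel_measurable dV" if "g \<in> borel_measurable borel" for g :: "complex \<Rightarrow> 'c::topological_space"
    using measurable_compose[OF id_dV that] by simp
  have dist_le: "(\<integral>\<^sup>+z. ennreal ((cmod (h z - \<phi> n z))\<^sup>2) \<partial>dV) \<le> ennreal (e\<^sup>2)"
    if "\<And>m. m \<ge> N \<Longrightarrow> norm (X m - X n) < e" for N n e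
  proof -
    have "(\<integral>\<^sup>+z. ennreal ((cmod (h z - \<phi> n z))\<^sup>2) \<partial>dV)
        = (\<integral>\<^sup>+z. liminf (\<lambda>m. ennreal ((cmod (\<phi> m z - \<phi> n z))\<^sup>2)) \<partial>dV)"
    proof (rule nn_integral_cong)
      fix z
      have "(\<lambda>m. ennreal ((cmod (\<phi> m z - \<phi> n z))\<^sup>2)) \<longlonglongrightarrow> ennreal ((cmod (h z - \<phi> n z))\<^sup>2)"
        by (intro tendsto_intros lim tendsto_ennrealI)
      then show "ennreal ((cmod (h z - \<phi> n z))\<^sup>2) = liminf (\<lambda>m. ennreal ((cmod (\<phi> m z - \<phi> n z))\<^sup>2))"
        by (rule lim_imp_Liminf[OF sequentially_bot, symmetric])
    qed
    also have "\<dots> \<le> liminf (\<lambda>m. \<integral>\<^sup>+z. ennreal ((cmod (\<phi> m z - \<phi> n z))\<^sup>2) \<partial>dV)"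
      by (intro nn_integral_liminf dV_meas) measurable
    also have "\<dots> = liminf (\<lambda>m. ennreal ((norm (X m - X n))\<^sup>2))"
      using nn_integral_dV_norm_bergman[of "X _ - X n"] by (simp add: \<phi>_def fun_of_minus)
    also have "\<dots> \<le> ennreal (e\<^sup>2)"
    proof (rule Liminf_le)
      have "ennreal ((norm (X m - X n))\<^sup>2) \<le> ennreal (e\<^sup>2)" if "m \<ge> N" for m
        using \<open>\<And>m. m \<ge> N \<Longrightarrow> norm (X m - X n) < e\<close>[OF that] by (intro ennreal_leI power_mono) auto
      then show "\<forall>\<^sub>F m in sequentially. ennreal ((norm (X m - X n))\<^sup>2) \<le> ennreal (e\<^sup>2)"
        unfolding eventually_sequentially by blast
    qed simp
    finally show ?thesis .
  qed
  obtain N1 where N1: "\<And>m n. m \<ge> N1 \<Longrightarrow> n \<ge> N1 \<Longrightarrow> norm (X m - X n) < 1"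
    using XN[of 1] by auto
  have "(\<lambda>z. h z - \<phi> N1 z) \<in> bergman_carrier"
    unfolding bergman_carrier_def
  proof (intro CollectI conjI allI impI)
    show "(\<lambda>z. h z - \<phi> N1 z) holomorphic_on ball 0 1"
      using hol by (intro holomorphic_intros) (auto simp: \<phi>_def fun_of_holomorphic)
    show "integrable dV (\<lambda>z. (cmod (h z - \<phi> N1 z))\<^sup>2)"
    proof (rule integrableI_bounded)
      show "(\<lambda>z. (cmod (h z - \<phi> N1 z))\<^sup>2) \<in> borel_measurable dV"
        by (intro dV_meas) measurable
      show "(\<integral>\<^sup>+z. ennreal (norm ((cmod (h z - \<phi> N1 z))\<^sup>2)) \<partial>dV) < \<infinity>"
        using dist_le[of N1 N1 1] N1 by (simp add: order_le_less_trans)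
    qed
  qed (simp add: h_out \<phi>_def fun_of_outside)
  then have "(\<lambda>z. (h z - \<phi> N1 z) + fun_of (X N1) z) \<in> bergman_carrier"
    by (rule bergman_carrier_add) (rule fun_of)
  then have h_in: "h \<in> bergman_carrier"
    by (simp add: \<phi>_def)
  define L where "L = Abs_bergman h"
  have L: "fun_of L = h"
    using h_in by (simp add: L_def Abs_bergman_inverse)
  have "X \<longlonglongrightarrow> L"
  proof (rule LIMSEQ_I)
    fix e :: real assume "e > 0"
    then obtain N where N: "\<And>m n. m \<ge> N \<Longrightarrow> n \<ge> N \<Longrightarrow> norm (X m - X n) < e / 2"
      using XN[of "e / 2"] by auto
    have "norm (X n - L) < e" if "n \<ge> N" for n
    proof -
      have "ennreal ((norm (L - X n))\<^sup>2) = (\<integral>\<^sup>+z. ennreal ((cmod (h z - \<phi> n z))\<^sup>2) \<partial>dV)"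
        using nn_integral_dV_norm_bergman[of "L - X n"] by (simp add: fun_of_minus L \<phi>_def)
      also have "\<dots> \<le> ennreal ((e / 2)\<^sup>2)"
        using N that by (intro dist_le[of N]) auto
      finally have "(norm (L - X n))\<^sup>2 \<le> (e / 2)\<^sup>2"
        by (simp add: ennreal_le_iff)
      then have "norm (L - X n) \<le> e / 2"
        by (rule power2_le_imp_le) (use \<open>e > 0\<close> in simp)
      then show ?thesis
        using \<open>e > 0\<close> by (simp add: norm_minus_commute)
    qed
    then show "\<exists>N. \<forall>n\<ge>N. norm (X n - L) < e" by blast
  qed
  then show "convergent X" by (rule convergentI)
qed

instance bergman :: banach ..

section \<open>Riesz representation and Toeplitz operators\<close>

text \<open>The representing vector is the minimizer of \<open>J x = \<bar>x\<bar>\<^sup>2 - 2 \<phi> x\<close>: a minimizing sequence is Cauchy by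
  the parallelogram law, and the first variation of \<open>J\<close> at the minimum vanishes.\<close>

lemma riesz_representation:
  fixes \<phi> :: "'a::{real_inner, complete_space} \<Rightarrow> real"
  assumes "bounded_linear \<phi>"
  obtains r where "\<And>x. \<phi> x = inner r x"
proof -
  interpret \<phi>: bounded_linear \<phi> by fact
  define J where "J x = inner x x - 2 * \<phi> x" for x
  obtain B where B: "\<And>x. norm (\<phi> x) \<le> norm x * B"
    using \<phi>.bounded by blast
  have bdd: "bdd_below (range J)"
  proof (rule bdd_belowI2)
    fix x
    have "2 * \<phi> x \<le> 2 * (norm x * B)"
      using B[of x] by simp
    moreover have "0 \<le> (norm x - B)\<^sup>2" by simp
    ultimately show "- (B\<^sup>2) \<le> J x"
      unfolding J_def power2_norm_eq_inner[symmetric] by (simp add: power2_eq_square algebra_simps)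
  qed
  define m where "m = Inf (range J)"
  have m_le: "m \<le> J x" for x
    unfolding m_def using bdd by (intro cInf_lower) auto
  have par: "(norm (x - y))\<^sup>2 \<le> 2 * ((J x - m) + (J y - m))" for x y
  proof -
    have "4 * J ((1 / 2) *\<^sub>R (x + y)) = 2 * J x + 2 * J y - (norm (x - y))\<^sup>2"
      unfolding J_def power2_norm_eq_inner
      by (simp add: \<phi>.add \<phi>.scaleR inner_add inner_diff inner_commute algebra_simps)
    then show ?thesis
      using m_le[of "(1 / 2) *\<^sub>R (x + y)"] by simp
  qed
  have "\<exists>x. J x < m + 1 / real (Suc n)" for n
  proof -
    have "m < m + 1 / real (Suc n)" by simp
    then show ?thesis
      unfolding m_def using bdd by (subst (asm) cInf_less_iff) auto
  qed
  then obtain X where X: "\<And>n. J (X n) < m + 1 / real (Suc n)"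
    by metis
  have "Cauchy X"
  proof (rule CauchyI)
    fix e :: real assume e: "e > 0"
    then obtain N where N: "inverse (real (Suc N)) < e\<^sup>2 / 4"
      using reals_Archimedean[of "e\<^sup>2 / 4"] by auto
    have "norm (X a - X b) < e" if "a \<ge> N" "b \<ge> N" for a b
    proof -
      have "J (X k) - m < e\<^sup>2 / 4" if "k \<ge> N" for k
      proof -
        have "1 / real (Suc k) \<le> inverse (real (Suc N))"
          using that by (simp add: field_simps)
        then show ?thesis using X[of k] N by linarith
      qed
      note small = this[OF that(1)] this[OF that(2)]
      have "(norm (X a - X b))\<^sup>2 \<le> 2 * ((J (X a) - m) + (J (X b) - m))"
        by (rule par)
      also have "\<dots> < 2 * (e\<^sup>2 / 4 + e\<^sup>2 / 4)"
        using add_strict_mono[OF small] by (rule mult_strict_left_mono) simp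
      also have "\<dots> = e\<^sup>2" by simp
      finally have "(norm (X a - X b))\<^sup>2 < e\<^sup>2" .
      then show ?thesis
        by (rule power2_less_imp_less) (use e in simp)
    qed
    then show "\<exists>M. \<forall>m\<ge>M. \<forall>n\<ge>M. norm (X m - X n) < e" by blast
  qed
  then obtain r where r: "X \<longlonglongrightarrow> r"
    using Cauchy_convergent convergent_def by blast
  have "(\<lambda>n. J (X n)) \<longlonglongrightarrow> J r"
    unfolding J_def by (intro tendsto_intros r \<phi>.tendsto)
  moreover have "(\<lambda>n. m + 1 / real (Suc n)) \<longlonglongrightarrow> m + 0"
    by (intro tendsto_intros LIMSEQ_Suc[OF lim_1_over_n])
  ultimately have "J r \<le> m + 0"
    by (rule LIMSEQ_le) (use X less_imp_le in blast)
  then have min: "J r \<le> J x" for x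
    using m_le[of x] by simp
  have "\<phi> x = inner r x" for x
  proof (rule ccontr)
    define a where "a = inner r x - \<phi> x"
    define s where "s = inner x x"
    \<comment> \<open>\<open>- a / s\<close> would be the best step in the direction \<open>x\<close>; the denominator \<open>s + 1\<close> avoids dividing by zero\<close>
    define t where "t = - a / (s + 1)"
    assume "\<phi> x \<noteq> inner r x"
    then have "a \<noteq> 0" by (simp add: a_def)
    have s: "s \<ge> 0" by (simp add: s_def)
    have "J (r + t *\<^sub>R x) = J r + 2 * t * a + t\<^sup>2 * s"
      by (simp add: J_def \<phi>.add \<phi>.scaleR inner_add inner_commute a_def s_def power2_eq_square algebra_simps)
    then have "0 \<le> 2 * t * a + t\<^sup>2 * s"
      using min[of "r + t *\<^sub>R x"] by simp
    also have "\<dots> \<le> 2 * t * a + t * (t * (s + 1))"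
      by (simp add: power2_eq_square algebra_simps)
    also have "t * (s + 1) = - a"
      using s by (simp add: t_def)
    also have "2 * t * a + t * - a = - (a * a / (s + 1))"
      by (simp add: t_def)
    also have "\<dots> < 0"
      using \<open>a \<noteq> 0\<close> s by (simp add: zero_less_mult_iff flip: power2_eq_square)
    finally show False by simp
  qed
  then show thesis by (rule that)
qed

lemma bergman_scaleR_eq_scaleC: "c *\<^sub>R f = bergman_scaleC (of_real c) f"
  by (simp add: scaleR_bergman_def)

lemma bergman_inner_scaleC_left: "bergman_inner (bergman_scaleC c f) g = c * bergman_inner f g"
  by (simp add: bergman_inner_def bergman_scaleC.rep_eq mult.assoc)

lemma bergman_inner_scaleC_right: "bergman_inner f (bergman_scaleC c g) = cnj c * bergman_inner f g"
  by (simp add: bergman_inner_def bergman_scaleC.rep_eq mult.left_commute)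

text \<open>The Riesz vector of the real functional \<open>g \<mapsto> Re (F f g)\<close> represents the complex form as well: replacing
  \<open>g\<close> by \<open>\<i> g\<close> turns real parts into imaginary parts.\<close>

lemma Toeplitz_operator_exists:
  assumes F: "bounded_sesquilinear F" and B: "B \<ge> 0" and bound: "\<And>f g. cmod (F f g) \<le> B * norm f * norm g"
  obtains T where "is_Toeplitz F T" "norm T \<le> B"
proof -
  interpret bounded_bilinear F
    using F by (simp add: bounded_sesquilinear_def)
  have scaleC: "F (bergman_scaleC c f) g = c * F f g" "F f (bergman_scaleC c g) = cnj c * F f g" for c f g
    using F by (simp_all add: bounded_sesquilinear_def)
  have "\<exists>r. \<forall>g. Re (F f g) = inner r g" for f
  proof -
    have "bounded_linear (\<lambda>g. Re (F f g))"
      by (rule bounded_linear_compose[OF bounded_linear_Re bounded_linear_right])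
    then obtain r where "\<And>g. Re (F f g) = inner r g"
      using riesz_representation by blast
    then show ?thesis by blast
  qed
  then obtain t where t: "\<And>f g. inner (t f) g = Re (F f g)"
    by metis
  have t_inner: "bergman_inner (t f) g = F f g" for f g
  proof (rule complex_eqI)
    show "Re (bergman_inner (t f) g) = Re (F f g)"
      using t[of f g] by (simp add: inner_bergman_def)
    show "Im (bergman_inner (t f) g) = Im (F f g)"
      using t[of f "bergman_scaleC \<i> g"] by (simp add: inner_bergman_def bergman_inner_scaleC_right scaleC)
  qed
  have t_norm: "norm (t f) \<le> norm f * B" for f
  proof -
    have "norm (t f) * norm (t f) = Re (F f (t f))"
      using t[of f "t f"] by (simp add: power2_norm_eq_inner[symmetric] power2_eq_square)
    also have "\<dots> \<le> B * norm f * norm (t f)"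
      using complex_Re_le_cmod bound by (rule order_trans)
    finally show ?thesis
      using B by (cases "t f = 0") (simp_all add: mult.commute)
  qed
  have t_scaleC: "t (bergman_scaleC c f) = bergman_scaleC c (t f)" for c f
  proof -
    have "inner (t (bergman_scaleC c f)) g = inner (bergman_scaleC c (t f)) g" for g
      by (simp only: inner_bergman_def bergman_inner_scaleC_left t_inner scaleC)
    then show ?thesis using vector_eq_rdot by blast
  qed
  have "t (f + f') = t f + t f'" for f f'
  proof -
    have "inner (t (f + f')) g = inner (t f + t f') g" for g
      by (simp add: inner_add_left t add_left)
    then show ?thesis using vector_eq_rdot by blast
  qed
  moreover have "t (c *\<^sub>R f) = c *\<^sub>R t f" for c f
    by (simp add: bergman_scaleR_eq_scaleC t_scaleC)
  ultimately have lin: "bounded_linear t"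
    using t_norm by (rule bounded_linear_intro)
  show thesis
  proof (rule that[of "Blinfun t"])
    show "is_Toeplitz F (Blinfun t)"
      by (simp add: is_Toeplitz_def bounded_linear_Blinfun_apply[OF lin] t_inner t_scaleC)
    show "norm (Blinfun t) \<le> B"
      using t_norm B by (intro norm_blinfun_bound) (simp_all add: bounded_linear_Blinfun_apply[OF lin] mult.commute)
  qed
qed

section \<open>Boundedness of the forms\<close>

text \<open>Multiplying by a unimodular \<open>c\<close> before taking the real part treats the positive and negative parts
  of the real and of the imaginary part of a complex measure in a single family.\<close>

definition jordan_part :: "(complex set \<Rightarrow> complex) \<Rightarrow> complex \<Rightarrow> complex measure" where
  "jordan_part \<mu> c = positive_variation (\<lambda>A. Re (c * \<mu> A))"

lemma cintegrable_iff_jordan_parts: "cintegrable \<mu> \<phi> \<longleftrightarrow> (\<forall>c\<in>{1, - 1, - \<i>, \<i>}. integrable (jordan_part \<mu> c) \<phi>)"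
  by (simp add: cintegrable_def jordan_part_def)

lemma cintegral_eq_jordan_parts:
  "cintegral \<mu> \<phi> = (LINT z|jordan_part \<mu> 1. \<phi> z) - (LINT z|jordan_part \<mu> (- 1). \<phi> z)
     + \<i> * ((LINT z|jordan_part \<mu> (- \<i>). \<phi> z) - (LINT z|jordan_part \<mu> \<i>. \<phi> z))"
  by (simp add: cintegral_def jordan_part_def)

lemma cintegral_cong:
  assumes "\<And>z. z \<in> ball 0 1 \<Longrightarrow> \<phi> z = \<psi> z"
  shows "cintegral \<mu> \<phi> = cintegral \<mu> \<psi>"
proof -
  have "(LINT z|jordan_part \<mu> c. \<phi> z) = (LINT z|jordan_part \<mu> c. \<psi> z)" for c
    using assms by (intro Bochner_Integration.integral_cong) (auto simp: jordan_part_def space_positive_variation)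
  then show ?thesis by (simp add: cintegral_eq_jordan_parts)
qed

lemma cintegral_add:
  assumes "cintegrable \<mu> \<phi>" "cintegrable \<mu> \<psi>"
  shows "cintegral \<mu> (\<lambda>z. \<phi> z + \<psi> z) = cintegral \<mu> \<phi> + cintegral \<mu> \<psi>"
  using assms by (simp add: cintegral_eq_jordan_parts cintegrable_iff_jordan_parts algebra_simps)

lemma cintegral_mult_left:
  assumes "cintegrable \<mu> \<phi>"
  shows "cintegral \<mu> (\<lambda>z. a * \<phi> z) = a * cintegral \<mu> \<phi>"
  using assms by (simp add: cintegral_eq_jordan_parts cintegrable_iff_jordan_parts algebra_simps)

lemma cintegral_estimate:
  assumes meas: "\<And>c. \<phi> \<in> borel_measurable (jordan_part \<mu> c)"
    and bound: "\<And>c. cmod c = 1 \<Longrightarrow> (\<integral>\<^sup>+z. ennreal (cmod (\<phi> z)) \<partial>jordan_part \<mu> c) \<le> ennreal B" and B: "B \<ge> 0"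
  shows "cintegrable \<mu> \<phi>" and "cmod (cintegral \<mu> \<phi>) \<le> 4 * B"
proof -
  have int: "integrable (jordan_part \<mu> c) \<phi>" if "cmod c = 1" for c
    using meas bound[OF that] by (intro integrableI_bounded) (auto intro: order_le_less_trans)
  then show "cintegrable \<mu> \<phi>"
    by (simp add: cintegrable_iff_jordan_parts)
  have le: "cmod (LINT z|jordan_part \<mu> c. \<phi> z) \<le> B" if "cmod c = 1" for c
  proof -
    have "ennreal (cmod (LINT z|jordan_part \<mu> c. \<phi> z)) \<le> ennreal B"
      using integral_norm_bound_ennreal[OF int[OF that]] bound[OF that] by (rule order_trans)
    then show ?thesis using B by simp
  qed
  have "cmod (cintegral \<mu> \<phi>) \<le> (cmod (LINT z|jordan_part \<mu> 1. \<phi> z) + cmod (LINT z|jordan_part \<mu> (- 1). \<phi> z))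
     + cmod (\<i> * ((LINT z|jordan_part \<mu> (- \<i>). \<phi> z) - (LINT z|jordan_part \<mu> \<i>. \<phi> z)))"
    unfolding cintegral_eq_jordan_parts
    by (rule order_trans[OF norm_triangle_ineq]) (intro add_mono norm_triangle_ineq4 order_refl)
  also have "\<dots> \<le> (B + B) + (B + B)"
  proof (intro add_mono le)
    have "cmod (\<i> * ((LINT z|jordan_part \<mu> (- \<i>). \<phi> z) - (LINT z|jordan_part \<mu> \<i>. \<phi> z)))
      \<le> cmod (LINT z|jordan_part \<mu> (- \<i>). \<phi> z) + cmod (LINT z|jordan_part \<mu> \<i>. \<phi> z)"
      by (simp add: norm_mult norm_triangle_ineq4)
    also have "\<dots> \<le> B + B"
      by (intro add_mono le) auto
    finally show "cmod (\<i> * ((LINT z|jordan_part \<mu> (- \<i>). \<phi> z) - (LINT z|jordan_part \<mu> \<i>. \<phi> z))) \<le> B + B" .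
  qed auto
  finally show "cmod (cintegral \<mu> \<phi>) \<le> 4 * B" by simp
qed

text \<open>The real number behind \<^const>\<open>norm_bound\<close>. The powers of \<open>p\<close> in the two coefficients
  \<^const>\<open>M_coeff\<close> cancel because the index of the class is the mean of \<open>l\<close> and \<open>j\<close>.\<close>

definition form_const :: "real \<Rightarrow> nat \<Rightarrow> nat \<Rightarrow> (complex set \<Rightarrow> complex) \<Rightarrow> real" where
  "form_const p l j \<mu> = fact l * fact j / (Gamma ((real l + real j) / 2 + 1))\<^sup>2
     * enn2real (varpi p ((real l + real j) / 2) \<mu>)"

lemma form_const_nonneg: "form_const p l j \<mu> \<ge> 0"
  by (simp add: form_const_def)

lemma norm_bound_eq:
  assumes p: "0 < p" and \<mu>: "\<mu> l j \<in> M_class p ((real l + real j) / 2)"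
  shows "norm_bound p \<mu> l j = ennreal (form_const p l j (\<mu> l j))"
proof -
  define k where "k = (real l + real j) / 2"
  have G: "Gamma (k + 1) > 0"
    by (intro Gamma_real_pos) (simp add: k_def add_nonneg_pos)
  have M: "sqrt (M_coeff p (real n) k) = p powr (k - real n) * (fact n / Gamma (k + 1))" for n
  proof -
    have "M_coeff p (real n) k = (p powr (k - real n) * (fact n / Gamma (k + 1)))\<^sup>2"
      unfolding M_coeff_def using p
      by (simp add: power_mult_distrib powr_add[symmetric] power2_eq_square Gamma_fact add.commute)
    then show ?thesis
      using G by simp
  qed
  have "(k - real l) + (k - real j) = 0"
    by (simp add: k_def field_simps)
  then have "p powr (k - real l) * p powr (k - real j) = 1"
    using p by (simp only: powr_add[symmetric]) simp
  then have "sqrt (M_coeff p (real l) k) * sqrt (M_coeff p (real j) k) = fact l * fact j / (Gamma (k + 1))\<^sup>2"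
    unfolding M by (simp add: power2_eq_square mult_ac)
  moreover have "varpi p k (\<mu> l j) = ennreal (enn2real (varpi p k (\<mu> l j)))"
    using \<mu> by (simp add: M_class_def k_def)
  ultimately show ?thesis
    unfolding norm_bound_def form_const_def k_def[symmetric]
    by (metis ennreal_mult' enn2real_nonneg mult.commute)
qed

lemma variation_ball_le:
  assumes p: "0 < p" and \<mu>: "\<mu> \<in> M_class p ((real l + real j) / 2)" and w: "cmod w < 1"
  shows "variation \<mu> (ball w (1 / 2 * (1 - cmod w)))
    \<le> ennreal (form_const p l j \<mu> / (fact l * fact j) * (1 - cmod w) ^ (l + j + 2) * p ^ (l + j))"
proof -
  define k where "k = (real l + real j) / 2"
  define d where "d = 1 - cmod w"
  define X where "X = d powr (- 2 * (k + 1)) * (Gamma (k + 1))\<^sup>2 * p powr (- 2 * k)"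
  define v where "v = enn2real (varpi p k \<mu>)"
  have d: "d > 0" using w by (simp add: d_def)
  have G: "Gamma (k + 1) > 0"
    by (intro Gamma_real_pos) (simp add: k_def add_nonneg_pos)
  have X: "X > 0" using d G p by (simp add: X_def)
  have v: "varpi p k \<mu> = ennreal v"
    using \<mu> by (simp add: M_class_def k_def v_def)
  have "variation \<mu> (ball w (1 / 2 * d)) * ennreal X \<le> ennreal v"
    unfolding v[symmetric] varpi_def X_def d_def using w by (intro SUP_upper) simp
  then have "variation \<mu> (ball w (1 / 2 * d)) * ennreal X * ennreal (1 / X) \<le> ennreal v * ennreal (1 / X)"
    by (rule mult_right_mono) simp
  then have "variation \<mu> (ball w (1 / 2 * d)) \<le> ennreal (v / X)"
    using X by (simp add: mult.assoc v_def flip: ennreal_mult)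
  also have "v / X = form_const p l j \<mu> / (fact l * fact j) * d ^ (l + j + 2) * p ^ (l + j)"
  proof -
    have "- 2 * (k + 1) = - real (l + j + 2)" "- 2 * k = - real (l + j)"
      by (simp_all add: k_def field_simps)
    then have "d powr (- 2 * (k + 1)) = 1 / d ^ (l + j + 2)" "p powr (- 2 * k) = 1 / p ^ (l + j)"
      using d p by (simp_all only: powr_minus powr_realpow inverse_eq_divide)
    then show ?thesis
      unfolding X_def form_const_def k_def[symmetric] v_def[symmetric] by simp
  qed
  finally show ?thesis
    by (simp add: d_def)
qed

text \<open>The embedding is applied to each of the four Jordan parts, which accounts for the factor 4; the
  factor \<open>\<pi>\<close> comes from the normalization of the Bergman norm.\<close>

lemma measure_form_estimate:
  assumes p: "0 < p" "p < 1" and \<mu>: "\<mu> \<in> M_class p ((real l + real j) / 2)"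
  shows "cintegrable \<mu> (form_integrand l j f g)"
    and "cmod (measure_form \<mu> l j f g)
      \<le> 4 * pi * carleson_const p * form_const p l j \<mu> * ((norm f)\<^sup>2 + (norm g)\<^sup>2)"
proof -
  define K where "K = form_const p l j \<mu> / (fact l * fact j)"
  have K: "K \<ge> 0" by (simp add: K_def form_const_nonneg)
  have disk: "disk_measure \<mu>" using \<mu> by (simp add: M_class_def)
  have C: "carleson_const p \<ge> 0" using p by (simp add: carleson_const_def Let_def)
  define B where "B = K * fact l * fact j * carleson_const p * (pi * (norm f)\<^sup>2 + pi * (norm g)\<^sup>2)"
  have B: "B \<ge> 0" using K C by (simp add: B_def)
  have meas: "form_integrand l j f g \<in> borel_measurable (jordan_part \<mu> c)" for c
  proof -
    have "continuous_on (ball 0 1) (\<lambda>z. (deriv ^^ l) (fun_of f) z * cnj ((deriv ^^ j) (fun_of g) z))"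
      by (intro continuous_intros holomorphic_on_imp_continuous_on holomorphic_higher_deriv fun_of_holomorphic) auto
    then show ?thesis
      unfolding jordan_part_def form_integrand_def[abs_def]
      by (subst measurable_cong_sets[OF sets_positive_variation refl]) (rule borel_measurable_continuous_on_restrict)
  qed
  have bound: "(\<integral>\<^sup>+z. ennreal (cmod (form_integrand l j f g z)) \<partial>jordan_part \<mu> c) \<le> ennreal B" if c: "cmod c = 1" for c
  proof -
    have "(\<integral>\<^sup>+z. ennreal (cmod (form_integrand l j f g z)) \<partial>jordan_part \<mu> c)
       = (\<integral>\<^sup>+z. ennreal (cmod ((deriv ^^ l) (fun_of f) z) * cmod ((deriv ^^ j) (fun_of g) z)) \<partial>jordan_part \<mu> c)"
      by (simp add: form_integrand_def norm_mult)
    also have "\<dots> \<le> ennreal (K * fact l * fact j * carleson_const p)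
      * ((\<integral>\<^sup>+u\<in>ball 0 1. ennreal ((cmod (fun_of f u))\<^sup>2) \<partial>lborel)
       + (\<integral>\<^sup>+u\<in>ball 0 1. ennreal ((cmod (fun_of g u))\<^sup>2) \<partial>lborel))"
    proof (rule carleson_embedding[OF p K])
      show "sets (jordan_part \<mu> c) = sets (restrict_space borel (ball 0 1))"
        by (simp add: jordan_part_def sets_positive_variation)
      show "sigma_finite_measure (jordan_part \<mu> c)"
        unfolding jordan_part_def by (rule sigma_finite_positive_variation[OF disk c])
      fix w :: complex assume w: "cmod w < 1"
      have "cball w (1 / 2 * (1 - cmod w)) \<subseteq> ball 0 1"
        using w by (simp add: cball_subset_ball_iff field_simps)
      then have "emeasure (jordan_part \<mu> c) (ball w (1 / 2 * (1 - cmod w))) \<le> variation \<mu> (ball w (1 / 2 * (1 - cmod w)))"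
        unfolding jordan_part_def by (intro emeasure_positive_variation_le disk c ball_in_rc_borel)
      also have "\<dots> \<le> ennreal (K * (1 - cmod w) ^ (l + j + 2) * p ^ (l + j))"
        unfolding K_def by (rule variation_ball_le[OF p(1) \<mu> w])
      finally show "emeasure (jordan_part \<mu> c) (ball w (1 / 2 * (1 - cmod w))) \<le> ennreal (K * (1 - cmod w) ^ (l + j + 2) * p ^ (l + j))" .
    qed (simp_all add: fun_of_holomorphic)
    also have "\<dots> = ennreal B"
      unfolding B_def nn_integral_norm_bergman using K C
      by (subst ennreal_plus[symmetric], simp, simp, subst ennreal_mult) simp_all
    finally show ?thesis .
  qed
  show "cintegrable \<mu> (form_integrand l j f g)"
    by (rule cintegral_estimate[OF meas bound B])
  have "cmod (measure_form \<mu> l j f g) \<le> 4 * B"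
    unfolding measure_form_def by (rule cintegral_estimate[OF meas bound B])
  also have "4 * B = 4 * pi * carleson_const p * form_const p l j \<mu> * ((norm f)\<^sup>2 + (norm g)\<^sup>2)"
    by (simp add: B_def K_def algebra_simps)
  finally show "cmod (measure_form \<mu> l j f g)
      \<le> 4 * pi * carleson_const p * form_const p l j \<mu> * ((norm f)\<^sup>2 + (norm g)\<^sup>2)" .
qed

text \<open>Rescaling both arguments to unit norm turns the additive bound into a multiplicative one.\<close>

lemma norm_le_of_quadratic_bound:
  fixes F :: "'a::real_normed_vector \<Rightarrow> 'b::real_normed_vector \<Rightarrow> 'c::real_normed_vector"
  assumes scale: "\<And>c f g. F (c *\<^sub>R f) g = c *\<^sub>R F f g" "\<And>c f g. F f (c *\<^sub>R g) = c *\<^sub>R F f g"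
    and bound: "\<And>f g. norm (F f g) \<le> B * ((norm f)\<^sup>2 + (norm g)\<^sup>2)"
  shows "norm (F f g) \<le> 2 * B * norm f * norm g"
proof (cases "f = 0 \<or> g = 0")
  case True
  then have "F f g = 0"
    using scale(1)[of 0 f g] scale(2)[of f 0 g] by auto
  then show ?thesis using True by auto
next
  case False
  define u where "u = (1 / norm f) *\<^sub>R f"
  define v where "v = (1 / norm g) *\<^sub>R g"
  have "norm u = 1" "norm v = 1" using False by (simp_all add: u_def v_def)
  then have "norm (F u v) \<le> 2 * B"
    using bound[of u v] by simp
  moreover have "F f g = (norm f * norm g) *\<^sub>R F u v"
    using False by (simp add: u_def v_def scale)
  ultimately show ?thesis
    using mult_left_mono[of "norm (F u v)" "2 * B" "norm f * norm g"] by (simp add: mult_ac)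
qed

lemma form_integrand_plus_left:
  "z \<in> ball 0 1 \<Longrightarrow> form_integrand l j (f + f') g z = form_integrand l j f g z + form_integrand l j f' g z"
  using higher_deriv_add[OF fun_of_holomorphic fun_of_holomorphic open_ball, of z l f f']
  by (simp add: form_integrand_def plus_bergman.rep_eq distrib_right)

lemma form_integrand_plus_right:
  "z \<in> ball 0 1 \<Longrightarrow> form_integrand l j f (g + g') z = form_integrand l j f g z + form_integrand l j f g' z"
  using higher_deriv_add[OF fun_of_holomorphic fun_of_holomorphic open_ball, of z j g g']
  by (simp add: form_integrand_def plus_bergman.rep_eq distrib_left)

lemma form_integrand_scaleC_left:
  "z \<in> ball 0 1 \<Longrightarrow> form_integrand l j (bergman_scaleC c f) g z = c * form_integrand l j f g z"
  using higher_deriv_cmult[OF fun_of_holomorphic _ open_ball, of z l c f]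
  by (simp add: form_integrand_def bergman_scaleC.rep_eq)

lemma form_integrand_scaleC_right:
  "z \<in> ball 0 1 \<Longrightarrow> form_integrand l j f (bergman_scaleC c g) z = cnj c * form_integrand l j f g z"
  using higher_deriv_cmult[OF fun_of_holomorphic _ open_ball, of z j c g]
  by (simp add: form_integrand_def bergman_scaleC.rep_eq)

lemma measure_form_bounded_sesquilinear:
  assumes p: "0 < p" "p < 1" and \<mu>: "\<mu> \<in> M_class p ((real l + real j) / 2)"
  shows "bounded_sesquilinear (measure_form \<mu> l j)"
    and "cmod (measure_form \<mu> l j f g) \<le> 8 * pi * carleson_const p * form_const p l j \<mu> * norm f * norm g"
proof -
  let ?F = "measure_form \<mu> l j"
  note int = measure_form_estimate(1)[OF p \<mu>]
  have add: "?F (f + f') g = ?F f g + ?F f' g" "?F f (g + g') = ?F f g + ?F f g'" for f f' g g'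
    unfolding measure_form_def cintegral_add[OF int int, symmetric]
    by (intro cintegral_cong form_integrand_plus_left form_integrand_plus_right; simp)+
  have scaleC: "?F (bergman_scaleC c f) g = c * ?F f g" "?F f (bergman_scaleC c g) = cnj c * ?F f g" for c f g
    unfolding measure_form_def cintegral_mult_left[OF int, symmetric]
    by (intro cintegral_cong form_integrand_scaleC_left form_integrand_scaleC_right; simp)+
  have scaleR: "?F (c *\<^sub>R f) g = c *\<^sub>R ?F f g" "?F f (c *\<^sub>R g) = c *\<^sub>R ?F f g" for c f g
    by (simp_all add: bergman_scaleR_eq_scaleC scaleC scaleR_conv_of_real)
  have bound: "cmod (?F f g) \<le> 2 * (4 * pi * carleson_const p * form_const p l j \<mu>) * norm f * norm g" for f g
    by (rule norm_le_of_quadratic_bound[OF scaleR measure_form_estimate(2)[OF p \<mu>]])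
  then show "cmod (?F f g) \<le> 8 * pi * carleson_const p * form_const p l j \<mu> * norm f * norm g"
    by (simp add: mult.assoc)
  have "bounded_bilinear ?F"
  proof
    show "\<exists>K. \<forall>f g. norm (?F f g) \<le> norm f * norm g * K"
      using bound by (intro exI[of _ "2 * (4 * pi * carleson_const p * form_const p l j \<mu>)"]) (simp add: mult_ac)
  qed (rule add scaleR)+
  then show "bounded_sesquilinear ?F"
    by (simp add: bounded_sesquilinear_def scaleC)
qed

section \<open>Norm convergence of the series\<close>

lemma summable_on_of_infsum_ennreal_finite:
  fixes f :: "'a \<Rightarrow> real"
  assumes nonneg: "\<And>x. x \<in> A \<Longrightarrow> f x \<ge> 0" and fin: "(\<Sum>\<^sub>\<infinity>x\<in>A. ennreal (f x)) < \<infinity>"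
  shows "f summable_on A"
proof (rule nonneg_bdd_above_summable_on[OF nonneg], assumption, rule bdd_aboveI2)
  fix X assume "X \<in> {F. F \<subseteq> A \<and> finite F}"
  then have X: "X \<subseteq> A" "finite X" by auto
  have "ennreal (sum f X) = (\<Sum>x\<in>X. ennreal (f x))"
    using X nonneg by (intro sum_ennreal[symmetric]) auto
  also have "\<dots> \<le> (\<Sum>\<^sub>\<infinity>x\<in>A. ennreal (f x))"
    using X by (subst nonneg_infsum_complete) (auto intro: SUP_upper)
  also have "\<dots> = ennreal (enn2real (\<Sum>\<^sub>\<infinity>x\<in>A. ennreal (f x)))"
    using fin by simp
  finally show "sum f X \<le> enn2real (\<Sum>\<^sub>\<infinity>x\<in>A. ennreal (f x))"
    by simp
qed

theorem mainTheorem3: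
  fixes p :: real
  assumes "0 < p" and "p < 1"
  shows "\<exists>C>0. \<forall>\<mu> :: nat \<Rightarrow> nat \<Rightarrow> complex set \<Rightarrow> complex.
    (\<forall>l j. \<mu> l j \<in> M_class p ((real l + real j) / 2)) \<longrightarrow>
    norm_almost_finite_type p \<mu> \<longrightarrow>
    (\<forall>l j. (\<forall>f g. cintegrable (\<mu> l j) (form_integrand l j f g)) \<and>
           bounded_sesquilinear (measure_form (\<mu> l j) l j)) \<and>
    (\<exists>T :: nat \<Rightarrow> nat \<Rightarrow> bergman \<Rightarrow>\<^sub>L bergman.
       (\<forall>l j. is_Toeplitz (measure_form (\<mu> l j) l j) (T l j) \<and>
              ennreal (norm (T l j)) \<le> ennreal C * norm_bound p \<mu> l j) \<and>
       (\<lambda>(l, j). T l j) summable_on UNIV)"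
proof (intro exI[of _ "8 * pi * carleson_const p"] conjI allI impI)
  define C where "C = 8 * pi * carleson_const p"
  have C: "C > 0" using carleson_const_pos[OF assms] by (simp add: C_def)
  then show "8 * pi * carleson_const p > 0" by (simp add: C_def)
  fix \<mu> :: "nat \<Rightarrow> nat \<Rightarrow> complex set \<Rightarrow> complex"
  assume "\<forall>l j. \<mu> l j \<in> M_class p ((real l + real j) / 2)" and finite_type: "norm_almost_finite_type p \<mu>"
  then have \<mu>: "\<mu> l j \<in> M_class p ((real l + real j) / 2)" for l j by blast
  show "cintegrable (\<mu> l j) (form_integrand l j f g)" for l j f g
    by (rule measure_form_estimate(1)[OF assms \<mu>])
  show sesq: "bounded_sesquilinear (measure_form (\<mu> l j) l j)" for l j
    by (rule measure_form_bounded_sesquilinear(1)[OF assms \<mu>])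
  define b where "b l j = form_const p l j (\<mu> l j)" for l j
  have b: "b l j \<ge> 0" "norm_bound p \<mu> l j = ennreal (b l j)" for l j
    using norm_bound_eq[OF assms(1), of \<mu> l j] \<mu> by (simp_all add: b_def form_const_nonneg)
  have "\<exists>T. is_Toeplitz (measure_form (\<mu> l j) l j) T \<and> norm T \<le> C * b l j" for l j
  proof -
    have "cmod (measure_form (\<mu> l j) l j f g) \<le> C * b l j * norm f * norm g" for f g
      unfolding C_def b_def by (rule measure_form_bounded_sesquilinear(2)[OF assms \<mu>])
    then show ?thesis
      using Toeplitz_operator_exists[OF sesq[of l j], of "C * b l j"] C b(1)[of l j]
      by (metis less_imp_le mult_nonneg_nonneg)
  qed
  then obtain T where T: "\<And>l j. is_Toeplitz (measure_form (\<mu> l j) l j) (T l j)"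
      "\<And>l j. norm (T l j) \<le> C * b l j"
    by metis
  have "(\<lambda>x. b (fst x) (snd x)) summable_on UNIV"
  proof (rule summable_on_of_infsum_ennreal_finite)
    show "(\<Sum>\<^sub>\<infinity>x\<in>UNIV. ennreal (b (fst x) (snd x))) < \<infinity>"
      using finite_type by (simp add: norm_almost_finite_type_def b(2) case_prod_unfold)
  qed (rule b)
  then have "(\<lambda>x. C * b (fst x) (snd x)) summable_on UNIV"
    by (rule summable_on_cmult_right)
  then have "(\<lambda>x. norm (T (fst x) (snd x))) summable_on UNIV"
    by (rule summable_on_comparison_test) (auto intro: T)
  then have "(\<lambda>x. T (fst x) (snd x)) summable_on UNIV"
    by (rule abs_summable_summable)
  then have sum: "(\<lambda>(l, j). T l j) summable_on UNIV"
    by (simp add: case_prod_beta')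
  have "ennreal (norm (T l j)) \<le> ennreal C * norm_bound p \<mu> l j" for l j
    unfolding b(2) using T(2)[of l j] C b(1)[of l j] by (simp add: ennreal_leI flip: ennreal_mult)
  with T(1) sum show "\<exists>T :: nat \<Rightarrow> nat \<Rightarrow> bergman \<Rightarrow>\<^sub>L bergman.
       (\<forall>l j. is_Toeplitz (measure_form (\<mu> l j) l j) (T l j) \<and>
              ennreal (norm (T l j)) \<le> ennreal (8 * pi * carleson_const p) * norm_bound p \<mu> l j) \<and>
       (\<lambda>(l, j). T l j) summable_on UNIV"
    unfolding C_def by blast
qed

end
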